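(* Fix $s\in\mathbb{C}$ with $\sigma=\operatorname{Re}s>0$, and fix $x\in\mathbb{R}^{+}$. Let $-1<\lambda<0$, and let $a=0$ if $s$ is an odd integer and $a=1$ otherwise. Define $$I(s,x):=\frac{1}{2\pi i}\int_{\lambda-i\infty}^{\lambda+i\infty}\Gamma(z-1)\Gamma\left(1-\frac{z}{2}\right)\Gamma\left(1-\frac{z}{2}+s\right)\sin^2\left(\frac{\pi z}{4}\right)\sin\left(\frac{\pi z}{4}-\frac{\pi s}{2}\right)(4x)^{-\frac12 z}\,dz.$$ Then: (i) for $x>1$, \begin{align*} I(s,x)=-\frac{\pi}{2^{2-s}}\Bigg[&\frac{\Gamma\left(\frac14+\frac s2\right)}{\sqrt{2x}\,\Gamma\left(\frac14-\frac s2\right)}+\frac{a\,x^{-s-1}\cot\left(\frac{\pi s}{2}\right)}{2^{s+1}\sqrt{\pi}}\Gamma\left(s+\tfrac12\right)\left\{\left(1+\frac ix\right)^{-(s+\frac12)}+\left(1-\frac ix\right)^{-(s+\frac12)}\right\}\\ &-\frac{1}{x2^s\sin\left(\frac{\pi s}{2}\right)\Gamma(1-s)}\,{}_3F_2\left(\tfrac14,\tfrac34,1;\tfrac{1-s}{2},1-\tfrac s2;-\tfrac1{x^2}\right)\Bigg]; \end{align*} (ii) for $x\le1$, \begin{align*} I(s,x)=-\frac{\pi}{2^{2-s}}\Bigg[&\frac{\Gamma(s)\cos\left(\frac{\pi s}{2}\right)}{2^{s-1}\pi x}\left\{{}_3F_2\left(\tfrac s2,\tfrac{1+s}{2},1;\tfrac14,\tfrac34;-x^2\right)-1\right\}\\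 &+\frac{i\,\Gamma\left(s+\frac12\right)}{2^{s+1}\sqrt{\pi x}}\Big\{\sin\left(\frac\pi4+\frac{\pi s}{2}\right)\left((1+ix)^{-(s+\frac12)}-(1-ix)^{-(s+\frac12)}\right)\\ &\qquad+i\cos\left(\frac\pi4+\frac{\pi s}{2}\right)\left((1+ix)^{-(s+\frac12)}+(1-ix)^{-(s+\frac12)}-2\right)\Big\}\Bigg], \end{align*} where, if $x=1$, we additionally require that $\sigma<\frac12$.
   Context: The generalized hypergeometric function is ${}_qF_p(a_1,\dots,a_q;b_1,\dots,b_p;z)=\sum_{n\ge0}\frac{(a_1)_n\cdots(a_q)_n}{(b_1)_n\cdots(b_p)_n}\frac{z^n}{n!}$ with $(a)_n=a(a+1)\cdots(a+n-1)$, $(a)_0=1$ (at argument $-1$ the ${}_3F_2$ is the conditionally convergent series). Complex powers are principal values. For positive integers $s$ at which individual factors are singular, the corresponding expressions are understood as limiting values in $s$. *)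

theory Defs
  imports "HOL-Analysis.Analysis"
begin

(* eval_fps F z is the sum of the series F $ n * z ^ n, with no restriction to the disc of
   convergence; at boundary points such as z = -1 it is the (possibly only conditionally
   convergent) sum of the series. *)
definition hypergeometric :: "complex list \<Rightarrow> complex list \<Rightarrow> complex \<Rightarrow> complex" where
  "hypergeometric as bs z = eval_fps (fps_hypergeo as bs 1) z"

(* The integral over the upward vertical line Re z = c, with z = c + i t and dz = i dt. *)
definition vertical_integrable :: "real \<Rightarrow> (complex \<Rightarrow> complex) \<Rightarrow> bool" where
  "vertical_integrable c f \<longleftrightarrow> integrable lborel (\<lambda>t. f (Complex c t))"

definition vertical_integral :: "real \<Rightarrow> (complex \<Rightarrow> complex) \<Rightarrow> complex" where
  "vertical_integral c f = \<i> * (LINT t|lborel. f (Complex c t))"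

definition integrand :: "complex \<Rightarrow> real \<Rightarrow> complex \<Rightarrow> complex" where
  "integrand s x z =
     Gamma (z - 1) * Gamma (1 - z / 2) * Gamma (1 - z / 2 + s)
     * (sin (of_real pi * z / 4))\<^sup>2 * sin (of_real pi * z / 4 - of_real pi * s / 2)
     * of_real (4 * x) powr (- (1 / 2) * z)"

definition I_fun :: "real \<Rightarrow> complex \<Rightarrow> real \<Rightarrow> complex" where
  "I_fun lam s x = 1 / (2 * of_real pi * \<i>) * vertical_integral lam (integrand s x)"

definition a_coeff :: "complex \<Rightarrow> complex" where
  "a_coeff s = (if \<exists>n::int. odd n \<and> s = of_int n then 0 else 1)"

(* rGamma is the entire function 1 / Gamma, so a reciprocal Gamma factor vanishes at the poles
   of Gamma. The coefficient a is a separate argument, so that it can be kept fixed when a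
   limit in s is taken. *)
definition rhs_large :: "complex \<Rightarrow> complex \<Rightarrow> real \<Rightarrow> complex" where
  "rhs_large a s x =
     - (of_real pi / 2 powr (2 - s)) *
     ( Gamma (1/4 + s/2) / of_real (sqrt (2 * x)) * rGamma (1/4 - s/2)
     + a * of_real x powr (- s - 1) * cot (of_real pi * s / 2)
         / (2 powr (s + 1) * of_real (sqrt pi)) * Gamma (s + 1/2)
         * ((1 + \<i> / of_real x) powr (- (s + 1/2)) + (1 - \<i> / of_real x) powr (- (s + 1/2)))
     - 1 / (of_real x * 2 powr s * sin (of_real pi * s / 2)) * rGamma (1 - s)
         * hypergeometric [1/4, 3/4, 1] [(1 - s) / 2, 1 - s/2] (- (1 / (of_real x)\<^sup>2)))"

definition rhs_small :: "complex \<Rightarrow> real \<Rightarrow> complex" where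
  "rhs_small s x =
     - (of_real pi / 2 powr (2 - s)) *
     ( Gamma s * cos (of_real pi * s / 2) / (2 powr (s - 1) * of_real pi * of_real x)
         * (hypergeometric [s/2, (1 + s) / 2, 1] [1/4, 3/4] (- ((of_real x)\<^sup>2)) - 1)
     + \<i> * Gamma (s + 1/2) / (2 powr (s + 1) * of_real (sqrt (pi * x)))
         * ( sin (of_real pi / 4 + of_real pi * s / 2)
               * ((1 + \<i> * of_real x) powr (- (s + 1/2)) - (1 - \<i> * of_real x) powr (- (s + 1/2)))
           + \<i> * cos (of_real pi / 4 + of_real pi * s / 2)
               * ((1 + \<i> * of_real x) powr (- (s + 1/2))
                  + (1 - \<i> * of_real x) powr (- (s + 1/2)) - 2)))"

end

theory Submission
  imports Defs "HOL-Complex_Analysis.Complex_Analysis" "HOL-Real_Asymp.Real_Asymp"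
begin

text \<open>
  With \<open>z = 2 w\<close>, the duplication and reflection formulas reduce the integrand to a constant times
  \<open>\<Gamma>(w - 1/2) \<Gamma>(1 + s - w) tan(\<pi> w / 2) sin(\<pi> (w - s) / 2) x\<^sup>-\<^sup>w\<close>. Its trigonometric part changes sign
  under \<open>w \<mapsto> w + 2\<close>, and its Gamma part gets multiplied by a rational function of \<open>w\<close> that tends
  to 1. Hence the absolute integrals over the lines \<open>Re w = c - 2 m\<close> shrink asymptotically like
  \<open>x\<^sup>2\<^sup>m\<close>, those over \<open>Re w = c + 2 m\<close> like \<open>x\<^sup>-\<^sup>2\<^sup>m\<close>, and no Stirling formula is needed. Summing residues to
  the left gives the formula for \<open>x < 1\<close>, and to the right the one for \<open>x > 1\<close> and non-integral \<open>s\<close>: the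
  poles of the two Gamma factors produce binomial series, those of the tangent the
  \<open>\<^sub>3F\<^sub>2\<close> series. The cases \<open>x = 1\<close> and integral \<open>s\<close> follow by continuity of \<open>I\<close> in \<open>x\<close> and \<open>s\<close>.
\<close>

text \<open>The base line Re w = lam/2 lies in the strip -1/2 < Re w < 0, which is free of poles. To
  its left lie the points 1/2 - k with k >= 1 and the negative odd integers; to its right lie 1/2,
  the positive odd integers and the points 1 + s + k with k >= 0. The left sums therefore lack the
  terms at 1/2 and at 1, which is the origin of the \<open>- 2\<close> and the \<open>- 1\<close> in
  \<open>rhs_small\<close>, while the single pole 1/2 gives the Gamma quotient in
  \<open>rhs_large\<close>. Convergence of the 3F2 series is not established beforehand when
  shifting: its partial sums are expressed by binomial partial sums and line integrals, whose limits
  are known. The shift to the right takes s non-integral because for integral s the points 1 + s + k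
  meet the odd integers. At x = 1 the coefficients of the 3F2 series are of size n^(Re s - 1/2), so
  Re s < 1/2 is what makes them tend to 0.\<close>

section \<open>Exponential decay of the Gamma function in vertical strips\<close>

text \<open>In Euler's product for \<open>|\<Gamma>(a + it)| / \<Gamma>(a)\<close> every factor \<open>(a + k) / |a + k + it|\<close> increases with \<open>a\<close>.\<close>

lemma norm_Gamma_ratio_mono:
  fixes a b t :: real
  assumes "0 < a" "a \<le> b"
  shows "norm (Gamma (Complex a t)) / Gamma a \<le> norm (Gamma (Complex b t)) / Gamma b"
proof -
  define R where "R = (\<lambda>c n. norm (Gamma_series (Complex c t) n) / Gamma_series c n)"
  have lim: "R c \<longlonglongrightarrow> norm (Gamma (Complex c t)) / Gamma c" if "c > 0" for c
    unfolding R_def using Gamma_real_pos[OF that]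
    by (intro tendsto_divide tendsto_norm Gamma_series_LIMSEQ) simp
  have R_eq: "R c n = (\<Prod>k\<le>n. (c + k) / norm (Complex c t + of_nat k))" if "c > 0" for c n
  proof -
    have "norm (exp (Complex c t * complex_of_real (ln n))) = exp (c * ln n)"
      by simp
    then show ?thesis using that
      unfolding R_def Gamma_series_def
      by (simp add: norm_mult norm_divide pochhammer_prod prod_norm [symmetric]
          prod_dividef lessThan_Suc_atMost atLeast0AtMost atLeast0LessThan)
  qed
  have "R a n \<le> R b n" for n
  proof -
    have "(a + k) / norm (Complex a t + of_nat k) \<le> (b + k) / norm (Complex b t + of_nat k)" for k
    proof -
      define p q where "p = a + real k" and "q = b + real k"
      have pq: "0 < p" "p \<le> q" using assms by (auto simp: p_def q_def)
      have nz: "cmod (Complex p t) > 0" "cmod (Complex q t) > 0"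
        using pq by (auto simp: complex_eq_iff)
      have "p * cmod (Complex q t) \<le> q * cmod (Complex p t)"
      proof (rule power2_le_imp_le)
        have "p\<^sup>2 * (q\<^sup>2 + t\<^sup>2) \<le> q\<^sup>2 * (p\<^sup>2 + t\<^sup>2)"
          using power_mono[OF pq(2), of 2] pq by (simp add: algebra_simps mult_right_mono)
        then show "(p * cmod (Complex q t))\<^sup>2 \<le> (q * cmod (Complex p t))\<^sup>2"
          by (simp add: power_mult_distrib cmod_power2)
      qed (use pq in simp)
      moreover have "Complex a t + of_nat k = Complex p t" "Complex b t + of_nat k = Complex q t"
        by (auto simp: complex_eq_iff p_def q_def)
      ultimately show ?thesis
        using nz by (simp add: field_simps flip: p_def q_def)
    qed
    then show ?thesis
      using assms by (subst (1 2) R_eq) (auto intro!: prod_mono divide_nonneg_nonneg)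
  qed
  then show ?thesis
    using LIMSEQ_le[OF lim lim] assms by fastforce
qed

lemma norm_Gamma_half:
  "norm (Gamma (Complex (1/2) t)) \<le> sqrt (2 * pi) * exp (- (pi / 2) * \<bar>t\<bar>)"
proof (rule power2_le_imp_le)
  define z where "z = Complex (1/2) t"
  have z': "1 - z = cnj z" by (simp add: z_def complex_eq_iff)
  have "of_real ((norm (Gamma z))\<^sup>2) = Gamma z * cnj (Gamma z)"
    by (simp only: complex_norm_square)
  also have "\<dots> = of_real pi / sin (of_real pi * z)"
    using Gamma_reflection_complex[of z] by (simp add: cnj_Gamma z')
  also have "of_real pi * z = of_real pi / 2 + \<i> * of_real (pi * t)"
    by (simp add: z_def complex_eq_iff)
  also have "sin \<dots> = cos (\<i> * of_real (pi * t))"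
    by (subst sin_add) simp
  also have "\<dots> = of_real (cosh (pi * t))"
    by (simp add: cos_exp_eq cosh_field_def exp_minus flip: exp_of_real)
  finally have "complex_of_real ((norm (Gamma z))\<^sup>2) = of_real (pi / cosh (pi * t))" by simp
  then have "(norm (Gamma z))\<^sup>2 = pi / cosh (pi * t)"
    by (simp only: of_real_eq_iff)
  also have "\<dots> \<le> pi / (exp (pi * \<bar>t\<bar>) / 2)"
  proof -
    have "exp (pi * \<bar>t\<bar>) / 2 \<le> cosh (pi * t)"
      by (cases "t \<ge> 0") (simp_all add: cosh_field_def)
    then show ?thesis by (intro divide_left_mono) auto
  qed
  also have "\<dots> = (sqrt (2 * pi) * exp (- (pi / 2) * \<bar>t\<bar>))\<^sup>2"
    by (simp add: power_mult_distrib exp_double [symmetric] exp_minus field_simps)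
  finally show "(norm (Gamma (Complex (1/2) t)))\<^sup>2 \<le> \<dots>" by (simp add: z_def)
qed auto

text \<open>Each use of Gamma(z + 1) = z Gamma(z) costs a linear factor, which any small loss in the
  exponential rate absorbs. Hence \<open>r\<close> stays strictly below pi/2 and is general in the
  induction.\<close>

lemma norm_Gamma_nat_plus_half:
  assumes "r < pi / 2"
  shows "\<exists>C. \<forall>t. norm (Gamma (Complex (real m + 1/2) t)) \<le> C * exp (- r * \<bar>t\<bar>)"
  using assms
proof (induction m arbitrary: r)
  case 0
  have "norm (Gamma (Complex (1/2) t)) \<le> sqrt (2 * pi) * exp (- r * \<bar>t\<bar>)" for t
  proof -
    have "exp (- (pi / 2) * \<bar>t\<bar>) \<le> exp (- r * \<bar>t\<bar>)"
      using 0 mult_right_mono[of r "pi/2" "\<bar>t\<bar>"] by simp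
    then have "sqrt (2 * pi) * exp (- (pi / 2) * \<bar>t\<bar>) \<le> sqrt (2 * pi) * exp (- r * \<bar>t\<bar>)"
      by (intro mult_left_mono) auto
    then show ?thesis using norm_Gamma_half[of t] by linarith
  qed
  then show ?case by auto
next
  case (Suc m)
  \<comment> \<open>The induction hypothesis is used at the midpoint of r and pi/2; the gap
    \<open>e\<close> pays for the factor |z|.\<close>
  define r' where "r' = (r + pi / 2) / 2"
  define e where "e = r' - r"
  have r': "r' < pi / 2" and e: "e > 0" using Suc.prems by (auto simp: r'_def e_def)
  obtain C where C: "\<And>t. norm (Gamma (Complex (real m + 1/2) t)) \<le> C * exp (- r' * \<bar>t\<bar>)"
    using Suc.IH[OF r'] by blast
  have C0: "C \<ge> 0" using order_trans[OF norm_ge_zero C[of 0]] by simp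
  have "norm (Gamma (Complex (real (Suc m) + 1/2) t)) \<le> (real m + 1/2 + 1 / e) * C * exp (- r * \<bar>t\<bar>)" for t
  proof -
    define z where "z = Complex (real m + 1/2) t"
    have "z \<noteq> 0" "z \<notin> \<int>\<^sub>\<le>\<^sub>0"
      by (auto simp: z_def complex_eq_iff elim!: nonpos_Ints_cases)
    moreover have "Complex (real (Suc m) + 1/2) t = z + 1" by (simp add: z_def complex_eq_iff)
    ultimately have "norm (Gamma (Complex (real (Suc m) + 1/2) t)) = norm z * norm (Gamma z)"
      by (simp add: Gamma_plus1 norm_mult)
    also have "norm z \<le> (real m + 1/2) + \<bar>t\<bar>"
      using cmod_le[of z] by (simp add: z_def)
    also have "\<dots> \<le> (real m + 1/2 + 1 / e) * exp (e * \<bar>t\<bar>)"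
    proof -
      have "e * \<bar>t\<bar> \<le> exp (e * \<bar>t\<bar>)" using exp_ge_add_one_self[of "e * \<bar>t\<bar>"] by linarith
      then have "\<bar>t\<bar> \<le> 1 / e * exp (e * \<bar>t\<bar>)" using e by (simp add: field_simps)
      moreover have "(real m + 1/2) * 1 \<le> (real m + 1/2) * exp (e * \<bar>t\<bar>)"
        using e by (intro mult_left_mono) auto
      ultimately show ?thesis by (simp add: algebra_simps)
    qed
    also have "norm (Gamma z) \<le> C * exp (- r' * \<bar>t\<bar>)" using C by (simp add: z_def)
    finally have "norm (Gamma (Complex (real (Suc m) + 1/2) t))
        \<le> (real m + 1/2 + 1 / e) * exp (e * \<bar>t\<bar>) * (C * exp (- r' * \<bar>t\<bar>))"
      using e by (simp add: mult_left_mono mult_right_mono)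
    also have "\<dots> = (real m + 1/2 + 1 / e) * C * exp (e * \<bar>t\<bar> - r' * \<bar>t\<bar>)"
      by (simp add: exp_diff exp_minus field_simps)
    also have "e * \<bar>t\<bar> - r' * \<bar>t\<bar> = - r * \<bar>t\<bar>" by (simp add: e_def algebra_simps)
    finally show ?thesis .
  qed
  then show ?case by blast
qed

text \<open>\<open>norm_Gamma_ratio_mono\<close> carries the decay from one half-integer line to the
  right of the strip back to every line inside it, and Gamma(Re z) is bounded on the compact
  interval.\<close>

lemma norm_Gamma_right_strip:
  assumes "0 < a" "r < pi / 2"
  shows "\<exists>C. \<forall>z. a \<le> Re z \<longrightarrow> Re z \<le> b \<longrightarrow> norm (Gamma z) \<le> C * exp (- r * \<bar>Im z\<bar>)"
proof -
  obtain m where m: "b \<le> real m" using real_arch_simple by blast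
  define B where "B = real m + 1/2"
  have B: "B > 0" "b \<le> B" using m by (auto simp: B_def)
  obtain C where C: "\<And>t. norm (Gamma (Complex B t)) \<le> C * exp (- r * \<bar>t\<bar>)"
    using norm_Gamma_nat_plus_half[OF assms(2), of m] unfolding B_def by blast
  have C0: "C \<ge> 0" using order_trans[OF norm_ge_zero C[of 0]] by simp
  have "continuous_on {a..b} (Gamma :: real \<Rightarrow> real)"
    using assms by (intro continuous_on_Gamma) (auto elim!: nonpos_Ints_cases)
  then have "bounded (Gamma ` {a..b} :: real set)"
    by (intro compact_imp_bounded compact_continuous_image) auto
  then obtain M where M: "\<And>x. x \<in> {a..b} \<Longrightarrow> norm (Gamma x) \<le> M"
    unfolding bounded_iff by blast
  have "norm (Gamma z) \<le> (M / Gamma B * C) * exp (- r * \<bar>Im z\<bar>)" if "a \<le> Re z" "Re z \<le> b" for z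
  proof -
    have pos: "Gamma (Re z) > 0" "Gamma B > 0" using that assms B by (auto intro!: Gamma_real_pos)
    have "norm (Gamma z) / Gamma (Re z) \<le> norm (Gamma (Complex B (Im z))) / Gamma B"
      using norm_Gamma_ratio_mono[of "Re z" B "Im z"] that assms B by simp
    also have "\<dots> \<le> C * exp (- r * \<bar>Im z\<bar>) / Gamma B" 
      using pos by (intro divide_right_mono C) auto
    finally have "norm (Gamma z) \<le> Gamma (Re z) * (C * exp (- r * \<bar>Im z\<bar>) / Gamma B)"
      using pos by (simp add: field_simps)
    also have "\<dots> \<le> M * (C * exp (- r * \<bar>Im z\<bar>) / Gamma B)"
      using M[of "Re z"] that pos C0 by (intro mult_right_mono) auto
    finally show ?thesis by (simp add: field_simps)
  qed
  then show ?thesis by blast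
qed

text \<open>Gamma(z) is Gamma(z + n) divided by a Pochhammer product. For |Im z| >= 1 every factor
  of that product has modulus at least 1, so the bound from the right half-plane survives.\<close>

lemma norm_Gamma_strip:
  assumes "r < pi / 2"
  shows "\<exists>C. \<forall>z. a \<le> Re z \<longrightarrow> Re z \<le> b \<longrightarrow> 1 \<le> \<bar>Im z\<bar> \<longrightarrow> norm (Gamma z) \<le> C * exp (- r * \<bar>Im z\<bar>)"
proof -
  obtain n where n: "- a < real n" using reals_Archimedean2 by blast
  obtain C where C: "\<And>z. a + n \<le> Re z \<Longrightarrow> Re z \<le> b + n \<Longrightarrow> norm (Gamma z) \<le> C * exp (- r * \<bar>Im z\<bar>)"
    using norm_Gamma_right_strip[of "a + n" r "b + n"] n assms by fastforce
  have "norm (Gamma z) \<le> C * exp (- r * \<bar>Im z\<bar>)" if z: "a \<le> Re z" "Re z \<le> b" "1 \<le> \<bar>Im z\<bar>" for z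
  proof -
    have nI: "z \<notin> \<int>\<^sub>\<le>\<^sub>0" using z by (auto elim!: nonpos_Ints_cases)
    have "1 \<le> norm (pochhammer z n)"
    proof -
      have "1 \<le> norm (z + of_nat k)" for k
        using abs_Im_le_cmod[of "z + of_nat k"] z by simp
      then show ?thesis by (auto simp: pochhammer_prod simp flip: prod_norm intro!: prod_ge_1)
    qed
    then have "norm (Gamma z) \<le> norm (pochhammer z n) * norm (Gamma z)"
      using mult_right_mono[of 1 "norm (pochhammer z n)" "norm (Gamma z)"] by simp
    also have "pochhammer z n = Gamma (z + of_nat n) / Gamma z" using nI by (rule pochhammer_Gamma)
    then have "norm (pochhammer z n) * norm (Gamma z) = norm (Gamma (z + of_nat n))"
      using nI by (simp add: norm_divide Gamma_eq_zero_iff)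
    also have "\<dots> \<le> C * exp (- r * \<bar>Im z\<bar>)" using C[of "z + of_nat n"] z by simp
    finally show ?thesis .
  qed
  then show ?thesis by blast
qed

section \<open>Shifting vertical lines of integration\<close>

lemma integrable_exp_neg_abs: "integrable lborel (\<lambda>t::real. exp (- \<bar>t\<bar>))"
proof -
  define g where "g = (\<lambda>t::real. indicator {0..} t *\<^sub>R exp (- t))"
  have "(\<lambda>t::real. exp (- 1 * t)) absolutely_integrable_on {0..}"
    by (intro nonnegative_absolutely_integrable_1 integrable_on_exp_minus_to_infinity) auto
  then have "integrable lborel g"
    unfolding set_integrable_def g_def by (subst (asm) integrable_completion) auto
  moreover from this have "integrable lborel (\<lambda>t. g (- t))"
    using lborel_integrable_real_affine[of g "-1" 0] by simp
  ultimately have "integrable lborel (\<lambda>t. g t + g (- t))" by (rule Bochner_Integration.integrable_add)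
  then show ?thesis
    by (rule Bochner_Integration.integrable_bound) (auto simp: g_def indicator_def)
qed

lemma continuous_on_vertical_line:
  assumes "f holomorphic_on A" "\<And>t. Complex c t \<in> A"
  shows "continuous_on UNIV (\<lambda>t. f (Complex c t))"
proof (rule continuous_on_compose2[OF holomorphic_on_imp_continuous_on[OF assms(1)]])
  show "continuous_on UNIV (\<lambda>t. Complex c t)"
    unfolding Complex_eq by (intro continuous_intros)
qed (use assms(2) in auto)

lemma integrable_vertical_line:
  assumes cont: "continuous_on UNIV (\<lambda>t. f (Complex c t) :: complex)"
    and decay: "\<And>t. T \<le> \<bar>t\<bar> \<Longrightarrow> norm (f (Complex c t)) \<le> C * exp (- \<bar>t\<bar>)"
  shows "integrable lborel (\<lambda>t. f (Complex c t))"
proof -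
  have "bounded ((\<lambda>t. f (Complex c t)) ` {-T..T})"
    by (intro compact_imp_bounded compact_continuous_image continuous_on_subset[OF cont]) auto
  then obtain M where M: "\<And>t. t \<in> {-T..T} \<Longrightarrow> norm (f (Complex c t)) \<le> M"
    unfolding bounded_iff by blast
  \<comment> \<open>For |t| < T the inequality 1 <= exp |T| * exp (- |t|) gives the constant bound
    \<open>M\<close> an exponential shape.\<close>
  define K where "K = \<bar>C\<bar> + \<bar>M\<bar> * exp \<bar>T\<bar>"
  have "norm (f (Complex c t)) \<le> K * exp (- \<bar>t\<bar>)" for t
  proof (cases "T \<le> \<bar>t\<bar>")
    case True
    have "C * exp (- \<bar>t\<bar>) \<le> K * exp (- \<bar>t\<bar>)"
      by (intro mult_right_mono) (auto simp: K_def intro: add_increasing2)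
    then show ?thesis using decay[OF True] by linarith
  next
    case False
    then have "norm (f (Complex c t)) \<le> \<bar>M\<bar> * 1" using M[of t] by fastforce
    also have "\<dots> \<le> \<bar>M\<bar> * (exp \<bar>T\<bar> * exp (- \<bar>t\<bar>))"
      using False by (intro mult_left_mono) (auto simp flip: exp_add)
    also have "\<dots> \<le> K * exp (- \<bar>t\<bar>)"
      by (simp add: K_def algebra_simps)
    finally show ?thesis .
  qed
  then show ?thesis
    by (intro Bochner_Integration.integrable_bound
          [OF integrable_mult_right[OF integrable_exp_neg_abs, of K]]
        AE_I2) (use borel_measurable_continuous_onI[OF cont] in simp, smt (verit) real_norm_def)
qed

text \<open>Contour integrals along vertical segments yield gauge integrals over [-n, n]; this
  passes from them to the Lebesgue integral over the whole line.\<close>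

lemma tendsto_integral_symmetric:
  fixes g :: "real \<Rightarrow> complex"
  assumes "integrable lborel g"
  shows "(\<lambda>n. integral {- real n..real n} g) \<longlonglongrightarrow> (LINT t|lborel. g t)"
proof -
  have "(\<lambda>n. LINT t|lborel. indicator {- real n..real n} t *\<^sub>R g t) \<longlonglongrightarrow> (LINT t|lborel. g t)"
  proof (rule integral_dominated_convergence[where w = "\<lambda>t. norm (g t)"])
    show "AE t in lborel. (\<lambda>n. indicator {- real n..real n} t *\<^sub>R g t) \<longlonglongrightarrow> g t"
    proof (intro AE_I2 tendsto_eventually)
      fix t :: real
      obtain N where "\<bar>t\<bar> \<le> real N" using real_arch_simple by blast
      then show "\<forall>\<^sub>F n in sequentially. indicator {- real n..real n} t *\<^sub>R g t = g t"
        by (intro eventually_sequentiallyI[of N]) (auto simp: indicator_def)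
    qed
    show "AE t in lborel. norm (indicator {- real n..real n} t *\<^sub>R g t) \<le> norm (g t)" for n
      by (intro AE_I2) (auto simp: indicator_def)
  qed (use assms in auto)
  moreover have "(LINT t|lborel. indicator {- real n..real n} t *\<^sub>R g t) = integral {- real n..real n} g" for n
  proof -
    have "set_integrable lborel {- real n..real n} g"
      unfolding set_integrable_def
      by (intro integrable_mult_indicator assms) auto
    from set_borel_integral_eq_integral(2)[OF this] show ?thesis
      by (simp add: set_lebesgue_integral_def)
  qed
  ultimately show ?thesis by simp
qed

lemma rectangle_residue:
  assumes "a' < a" "a < b" "b < b'" "T > 0" "finite P"
    and P: "\<And>p. p \<in> P \<Longrightarrow> a < Re p \<and> Re p < b \<and> \<bar>Im p\<bar> < T"
    and holo: "f holomorphic_on {z. a' < Re z \<and> Re z < b'} - P"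
  shows "\<i> * integral {-T..T} (\<lambda>t. f (Complex b t)) - \<i> * integral {-T..T} (\<lambda>t. f (Complex a t))
         + contour_integral (linepath (Complex a (-T)) (Complex b (-T))) f
         + contour_integral (linepath (Complex b T) (Complex a T)) f
       = 2 * of_real pi * \<i> * (\<Sum>p\<in>P. residue f p)"
proof -
  define S where "S = {z. a' < Re z \<and> Re z < b'}"
  define a1 a2 a3 a4 where "a1 = Complex a (-T)" and "a2 = Complex b (-T)"
    and "a3 = Complex b T" and "a4 = Complex a T"
  have S: "open S" "convex S" unfolding S_def
    by (simp add: Collect_conj_eq open_Int open_halfspace_Re_gt open_halfspace_Re_lt,
        simp add: Collect_conj_eq convex_Int convex_halfspace_Re_gt convex_halfspace_Re_lt)
  have pI: "path_image (rectpath a1 a3) \<subseteq> S - P"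
    using assms(1-4) P by (force simp: path_image_rectpath S_def a1_def a3_def)
  have segs: "closed_segment a1 a2 \<union> closed_segment a2 a3 \<union> closed_segment a3 a4 \<union> closed_segment a4 a1 \<subseteq> S - P"
    using pI by (simp add: rectpath_def Let_def path_image_join a1_def a2_def a3_def a4_def)
  have cont: "continuous_on (S - P) f"
    using holo holomorphic_on_imp_continuous_on by (simp add: S_def)
  have ci: "f contour_integrable_on linepath a1 a2" "f contour_integrable_on linepath a2 a3"
     "f contour_integrable_on linepath a3 a4" "f contour_integrable_on linepath a4 a1"
     "continuous_on (closed_segment a4 a1) f" "f contour_integrable_on linepath a1 a4"
    using segs continuous_on_subset[OF cont] 
    by (auto intro!: contour_integrable_continuous_linepath simp: closed_segment_commute[of a1 a4])
  have rp: "rectpath a1 a3 = linepath a1 a2 +++ linepath a2 a3 +++ linepath a3 a4 +++ linepath a4 a1"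
    by (simp add: rectpath_def Let_def a1_def a2_def a3_def a4_def)
  have "contour_integral (rectpath a1 a3) f = contour_integral (linepath a1 a2) f
     + contour_integral (linepath a2 a3) f + contour_integral (linepath a3 a4) f + contour_integral (linepath a4 a1) f"
    unfolding rp using ci by simp
  moreover have "contour_integral (rectpath a1 a3) f
      = of_real (2 * pi) * \<i> * (\<Sum>p\<in>P. winding_number (rectpath a1 a3) p * residue f p)"
  proof (rule Residue_theorem[where S = S and pts = P])
    show "\<forall>z. z \<notin> S \<longrightarrow> winding_number (rectpath a1 a3) z = 0"
    proof (intro allI impI winding_number_rectpath_outside)
      fix z assume "z \<notin> S"
      then show "z \<notin> cbox a1 a3" using assms(1-4) by (auto simp: S_def a1_def a3_def in_cbox_complex_iff)
    qed (use assms in \<open>auto simp: a1_def a3_def\<close>)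
  qed (use S(1) convex_connected[OF S(2)] holo[folded S_def] pI \<open>finite P\<close> in auto)
  moreover have "winding_number (rectpath a1 a3) p = 1" if "p \<in> P" for p
    using P[OF that] by (intro winding_number_rectpath) (auto simp: a1_def a3_def in_box_complex_iff)
  moreover have "contour_integral (linepath a2 a3) f = \<i> * integral {-T..T} (\<lambda>t. f (Complex b t))"
  proof -
    have "(f has_contour_integral contour_integral (linepath a2 a3) f) (linepath a2 a3)"
      using ci has_contour_integral_integral by blast
    then have "((\<lambda>t. f (Complex b t)) has_integral (-\<i> * contour_integral (linepath a2 a3) f)) {-T..T}"
      using assms by (subst (asm) has_contour_integral_linepath_same_Re_iff) (auto simp: a2_def a3_def)
    then show ?thesis by (simp add: integral_unique)
  qed
  moreover have "contour_integral (linepath a4 a1) f = - (\<i> * integral {-T..T} (\<lambda>t. f (Complex a t)))"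
  proof -
    have "(f has_contour_integral contour_integral (linepath a1 a4) f) (linepath a1 a4)"
      using ci has_contour_integral_integral by blast
    then have "((\<lambda>t. f (Complex a t)) has_integral (-\<i> * contour_integral (linepath a1 a4) f)) {-T..T}"
      using assms by (subst (asm) has_contour_integral_linepath_same_Re_iff) (auto simp: a1_def a4_def)
    then show ?thesis using ci(5) by (subst contour_integral_reverse_linepath) (auto simp: integral_unique)
  qed
  ultimately show ?thesis
    by (simp add: a1_def a2_def a3_def a4_def algebra_simps)
qed

text \<open>The residue theorem is applied to rectangles of growing integer height n: the horizontal
  sides keep the length b - a, and on them f is at most |C| exp(-n). The wider strip from a' to b'
  supplies an open convex domain around all these rectangles.\<close>

lemma vertical_line_shift:
  assumes ab: "a' < a" "a < b" "b < b'" and "finite P"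
    and P: "\<And>p. p \<in> P \<Longrightarrow> a < Re p \<and> Re p < b"
    and holo: "f holomorphic_on {z. a' < Re z \<and> Re z < b'} - P"
    and decay: "\<And>z. a \<le> Re z \<Longrightarrow> Re z \<le> b \<Longrightarrow> T \<le> \<bar>Im z\<bar> \<Longrightarrow> norm (f z) \<le> C * exp (- \<bar>Im z\<bar>)"
  shows "integrable lborel (\<lambda>t. f (Complex a t))" "integrable lborel (\<lambda>t. f (Complex b t))"
    "(LINT t|lborel. f (Complex b t)) - (LINT t|lborel. f (Complex a t)) = 2 * of_real pi * (\<Sum>p\<in>P. residue f p)"
proof -
  define S where "S = {z. a' < Re z \<and> Re z < b'}"
  have cont: "continuous_on UNIV (\<lambda>t. f (Complex a t))" "continuous_on UNIV (\<lambda>t. f (Complex b t))"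
    by (rule continuous_on_vertical_line[OF holo]; use ab P in fastforce)+
  show int: "integrable lborel (\<lambda>t. f (Complex a t))" "integrable lborel (\<lambda>t. f (Complex b t))"
    by (rule integrable_vertical_line[where T = T and C = C];
        use cont decay[of "Complex a _"] decay[of "Complex b _"] ab in simp)+
  obtain T1 where T1: "\<And>p. p \<in> P \<Longrightarrow> \<bar>Im p\<bar> < T1"
  proof -
    have "\<bar>Im p\<bar> < Max (insert 0 ((\<lambda>p. \<bar>Im p\<bar>) ` P)) + 1" if "p \<in> P" for p
    proof -
      have "\<bar>Im p\<bar> \<le> Max (insert 0 ((\<lambda>p. \<bar>Im p\<bar>) ` P))"
        using that \<open>finite P\<close> by (intro Max_ge) auto
      then show ?thesis by linarith
    qed
    then show ?thesis using that by blast
  qed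
  define R where "R = 2 * of_real pi * \<i> * (\<Sum>p\<in>P. residue f p)"
  \<comment> \<open>\<open>h n\<close> is the error of the shift formula at height n; for large n it
    is minus the integral over the two horizontal sides.\<close>
  define h where "h = (\<lambda>n::nat. \<i> * integral {-real n..real n} (\<lambda>t. f (Complex b t))
      - \<i> * integral {-real n..real n} (\<lambda>t. f (Complex a t)) - R)"
  have lim: "h \<longlonglongrightarrow> \<i> * (LINT t|lborel. f (Complex b t)) - \<i> * (LINT t|lborel. f (Complex a t)) - R"
    unfolding h_def by (intro tendsto_intros tendsto_integral_symmetric int)
  have "\<forall>\<^sub>F n in sequentially. norm (h n) \<le> 2 * (b - a) * \<bar>C\<bar> * exp (- real n)"
  proof -
    obtain N where N: "max (max T T1) 1 \<le> real N" using real_arch_simple by blast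
    show ?thesis
    proof (rule eventually_sequentiallyI[of N])
      fix n :: nat assume n: "N \<le> n"
      then have n': "T \<le> real n" "T1 \<le> real n" "1 \<le> real n" using N by auto
      let ?l1 = "contour_integral (linepath (Complex a (- real n)) (Complex b (- real n))) f"
      let ?l2 = "contour_integral (linepath (Complex b (real n)) (Complex a (real n))) f"
      have "norm (contour_integral (linepath (Complex c u) (Complex d u)) f) \<le> (b - a) * \<bar>C\<bar> * exp (- real n)"
        if "\<bar>u\<bar> = real n" "(c, d) = (a, b) \<or> (c, d) = (b, a)" for u c d
      proof -
        have eq: "closed_segment (Complex c u) (Complex d u) = {z. Im z = u \<and> Re z \<in> {a..b}}"
          using ab that by (auto simp: closed_segment_same_Im closed_segment_eq_real_ivl)
        have sub: "{z. Im z = u \<and> Re z \<in> {a..b}} \<subseteq> {z. a' < Re z \<and> Re z < b'} - P"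
          using ab T1 n' that by fastforce
        have "norm (contour_integral (linepath (Complex c u) (Complex d u)) f)
            \<le> (\<bar>C\<bar> * exp (- real n)) * norm (Complex d u - Complex c u)"
        proof (rule contour_integral_bound_linepath)
          show "f contour_integrable_on linepath (Complex c u) (Complex d u)"
            using sub by (intro contour_integrable_continuous_linepath
                continuous_on_subset[OF holomorphic_on_imp_continuous_on[OF holo]]) (simp add: eq)
          fix z assume z: "z \<in> closed_segment (Complex c u) (Complex d u)"
          then have "norm (f z) \<le> C * exp (- \<bar>Im z\<bar>)"
            using that n' by (intro decay) (auto simp: eq)
          also have "\<dots> \<le> \<bar>C\<bar> * exp (- real n)" using z that by (simp add: eq mult_right_mono)
          finally show "norm (f z) \<le> \<bar>C\<bar> * exp (- real n)" .
        qed auto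
        also have "norm (Complex d u - Complex c u) = b - a"
          using that ab by (auto simp: cmod_def)
        finally show ?thesis by (simp add: mult_ac)
      qed
      note bnd = this
      have "\<i> * integral {-real n..real n} (\<lambda>t. f (Complex b t)) - \<i> * integral {-real n..real n} (\<lambda>t. f (Complex a t)) + ?l1 + ?l2 = R"
        unfolding R_def using T1 n' P by (intro rectangle_residue[OF ab _ \<open>finite P\<close> _ holo]) force+
      then have "h n = - (?l1 + ?l2)" by (simp add: h_def algebra_simps)
      then have "norm (h n) \<le> norm ?l1 + norm ?l2" by (metis norm_minus_cancel norm_triangle_ineq)
      also have "\<dots> \<le> 2 * (b - a) * \<bar>C\<bar> * exp (- real n)"
        using bnd[of "- real n" a b] bnd[of "real n" b a] by (simp add: algebra_simps)
      finally show "norm (h n) \<le> 2 * (b - a) * \<bar>C\<bar> * exp (- real n)" .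
    qed
  qed
  moreover have "(\<lambda>n. 2 * (b - a) * \<bar>C\<bar> * exp (- real n)) \<longlonglongrightarrow> 0"
    by real_asymp
  ultimately have "h \<longlonglongrightarrow> 0" by (rule Lim_null_comparison)
  with lim have "\<i> * (LINT t|lborel. f (Complex b t)) - \<i> * (LINT t|lborel. f (Complex a t)) - R = 0"
    using LIMSEQ_unique by blast
  then have "\<i> * ((LINT t|lborel. f (Complex b t)) - (LINT t|lborel. f (Complex a t))) = \<i> * (2 * of_real pi * (\<Sum>p\<in>P. residue f p))"
    by (simp add: R_def algebra_simps)
  then show "(LINT t|lborel. f (Complex b t)) - (LINT t|lborel. f (Complex a t)) = 2 * of_real pi * (\<Sum>p\<in>P. residue f p)"
    by simp
qed

section \<open>The reduced integrand\<close>

text \<open>Both bounds on the tangent below compare |sin|^2 with |cos|^2, and this identity reduces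
  the comparison to a real cosine.\<close>

lemma norm_cos_sin_diff: "(norm (cos z))\<^sup>2 - (norm (sin z))\<^sup>2 = cos (2 * Re z)" for z :: complex
proof -
  have "exp (2 * Im z) = (exp (Im z))\<^sup>2" by (simp add: exp_double)
  then show ?thesis
    unfolding norm_cos_squared norm_sin_squared cos_double_cos
    by (simp add: power2_diff power_inverse field_simps) (simp add: power2_eq_square power4_eq_xxxx field_simps)
qed

lemma norm_sin_le_exp_Im: "norm (sin z) \<le> exp \<bar>Im z\<bar>" for z :: complex
  using cmod_sin_le_exp[of 1 z] by simp

text \<open>Serves the base line, where pi w / 2 has real part between -pi/4 and 0, so that the
  tangent is bounded at every height.\<close>

lemma norm_tan_le_1:
  fixes z :: complex
  assumes "\<bar>Re z\<bar> \<le> pi / 4"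
  shows "norm (tan z) \<le> 1"
proof -
  have "cos (2 * Re z) \<ge> 0" using assms by (intro cos_ge_zero) auto
  then have "(norm (sin z))\<^sup>2 \<le> (norm (cos z))\<^sup>2" using norm_cos_sin_diff[of z] by linarith
  then have "norm (sin z) \<le> norm (cos z)" by (rule power2_le_imp_le) auto
  then show ?thesis by (simp add: tan_def norm_divide divide_le_eq_1)
qed

lemma norm_tan_le_2:
  fixes z :: complex
  assumes "1 \<le> \<bar>Im z\<bar>"
  shows "norm (tan z) \<le> 2"
proof -
  define E where "E = exp \<bar>Im z\<bar>"
  \<comment> \<open>From e >= 1 + 1 + 1/2. Then E - 1/E >= 5/2 - 2/5 > 2, which forces |cos z| >=
    1.\<close>
  have "E \<ge> 5/2"
  proof -
    have "5/2 \<le> exp (1::real)" using exp_lower_Taylor_quadratic[of 1] by simp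
    also have "\<dots> \<le> E" unfolding E_def using assms by (subst exp_le_cancel_iff)
    finally show ?thesis .
  qed
  moreover from this have "inverse E \<le> inverse (5/2)" by (intro le_imp_inverse_le) auto
  ultimately have "2 \<le> E - inverse E" by simp
  then have "2\<^sup>2 \<le> (E - inverse E)\<^sup>2" by (intro power_mono) auto
  also have "\<dots> = (exp (Im z) - inverse (exp (Im z)))\<^sup>2"
    by (auto simp: E_def abs_if exp_minus power2_commute)
  also have "\<dots> \<le> 4 * (norm (cos z))\<^sup>2" by (simp add: norm_cos_squared)
  finally have "1 \<le> (norm (cos z))\<^sup>2" by simp
  moreover have "(norm (sin z))\<^sup>2 \<le> (norm (cos z))\<^sup>2 + 1"
    using norm_cos_sin_diff[of z] cos_ge_minus_one[of "2 * Re z"] by linarith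
  ultimately have "(norm (sin z))\<^sup>2 \<le> (2 * norm (cos z))\<^sup>2"
    by (simp add: power_mult_distrib)
  then have "norm (sin z) \<le> 2 * norm (cos z)" by (rule power2_le_imp_le) auto
  moreover have "cos z \<noteq> 0" using \<open>1 \<le> (norm (cos z))\<^sup>2\<close> by auto
  ultimately show ?thesis by (simp add: tan_def norm_divide divide_le_eq)
qed

text \<open>Duplication and reflection leave 1 / (sin cos) at pi w / 2, which the squared sine of
  \<open>integrand\<close> turns into the tangent. Each family of possible poles then belongs to one
  factor: 1/2 - k to the first, 1 + s + k to the second, the odd integers to the third.\<close>

definition mellin_kernel :: "complex \<Rightarrow> real \<Rightarrow> complex \<Rightarrow> complex" where
  "mellin_kernel s x w = Gamma (w - 1/2) * Gamma (1 + s - w) * tan (of_real pi * w / 2)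
     * sin (of_real pi * (w - s) / 2) * of_real x powr (- w)"

text \<open>Balance of exponential rates: each Gamma factor decays at rate 3/2 < pi/2, the sine
  grows at rate pi/2 < 2, and 3/2 + 3/2 - 2 = 1 remains.\<close>

lemma kernel_bound_aux:
  assumes "norm (Gamma (w - 1/2)) \<le> C1 * exp (- (3/2) * \<bar>Im w\<bar>)"
    and "norm (Gamma (1 + s - w)) \<le> C2 * exp (- (3/2) * \<bar>Im (1 + s - w)\<bar>)"
    and "norm (tan (of_real pi * w / 2)) \<le> 2" "x > 0" "x powr (- Re w) \<le> X" "\<bar>Im s\<bar> \<le> M"
  shows "norm (mellin_kernel s x w) \<le> C1 * C2 * 2 * exp (4 * M) * X * exp (- \<bar>Im w\<bar>)"
proof -
  have C: "C1 \<ge> 0" "C2 \<ge> 0"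
    using order_trans[OF norm_ge_zero assms(1)] order_trans[OF norm_ge_zero assms(2)]
    by (simp_all add: zero_le_mult_iff)
  have "norm (sin (of_real pi * (w - s) / 2)) \<le> exp \<bar>pi * (Im w - Im s) / 2\<bar>"
    using norm_sin_le_exp_Im[of "of_real pi * (w - s) / 2"] by simp
  also have "\<bar>pi * (Im w - Im s) / 2\<bar> \<le> 2 * (\<bar>Im w\<bar> + \<bar>Im s\<bar>)"
  proof -
    have "\<bar>pi * (Im w - Im s) / 2\<bar> = (pi / 2) * \<bar>Im w - Im s\<bar>" by (simp add: abs_mult)
    also have "\<dots> \<le> 2 * (\<bar>Im w\<bar> + \<bar>Im s\<bar>)"
      using pi_less_4 by (intro mult_mono) auto
    finally show ?thesis .
  qed
  finally have sin: "norm (sin (of_real pi * (w - s) / 2)) \<le> exp (2 * (\<bar>Im w\<bar> + \<bar>Im s\<bar>))" by simp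
  have pow: "norm (complex_of_real x powr (- w)) \<le> X"
    using assms by (simp add: norm_powr_real_powr)
  have "norm (mellin_kernel s x w) \<le> (C1 * exp (- (3/2) * \<bar>Im w\<bar>)) * (C2 * exp (- (3/2) * \<bar>Im (1 + s - w)\<bar>)) * 2
      * exp (2 * (\<bar>Im w\<bar> + \<bar>Im s\<bar>)) * X"
    unfolding mellin_kernel_def norm_mult using C
    by (intro mult_mono assms sin pow mult_nonneg_nonneg norm_ge_zero) auto
  also have "\<dots> = C1 * C2 * 2 * X * exp (- (3/2) * \<bar>Im w\<bar> + - (3/2) * \<bar>Im (1 + s - w)\<bar> + 2 * (\<bar>Im w\<bar> + \<bar>Im s\<bar>))"
    by (simp only: exp_add) (simp add: mult_ac)
  also have "\<dots> \<le> C1 * C2 * 2 * X * exp (4 * M - \<bar>Im w\<bar>)"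
  proof (intro mult_left_mono mult_nonneg_nonneg)
    show "X \<ge> 0" using order_trans[OF norm_ge_zero pow] .
    \<comment> \<open>Replacing |Im (1 + s - w)| by |Im w| - |Im s| costs 3/2 |Im s|, and the sine
      costs another 2 |Im s|; 4 M covers both.\<close>
    have "- (3/2) * \<bar>Im w\<bar> + - (3/2) * \<bar>Im (1 + s - w)\<bar> + 2 * (\<bar>Im w\<bar> + \<bar>Im s\<bar>) \<le> 4 * M - \<bar>Im w\<bar>"
    proof -
      have "\<bar>Im w\<bar> - \<bar>Im s\<bar> \<le> \<bar>Im (1 + s - w)\<bar>" by simp
      moreover have "- (3/2) * W + - (3/2) * q + 2 * (W + S) \<le> 4 * M - W"
        if "W - S \<le> q" "S \<le> M" "0 \<le> S" for W q S :: real
        using that by (simp add: algebra_simps)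
      ultimately show ?thesis using assms(6) abs_ge_zero by blast
    qed
    then show "exp (- (3/2) * \<bar>Im w\<bar> + - (3/2) * \<bar>Im (1 + s - w)\<bar> + 2 * (\<bar>Im w\<bar> + \<bar>Im s\<bar>)) \<le> exp (4 * M - \<bar>Im w\<bar>)"
      by simp
  qed (use C in auto)
  finally show ?thesis by (simp add: exp_diff exp_minus field_simps)
qed

text \<open>The constant is uniform in s and x because this bound is the dominating function for
  limits in both parameters. An upper bound on x suffices, since the exponent -c of its power is
  positive.\<close>

lemma kernel_bound_base:
  assumes c: "- 1/2 < c" "c < 0"
  shows "\<exists>C. \<forall>s x t. 0 < Re s \<longrightarrow> Re s \<le> B \<longrightarrow> \<bar>Im s\<bar> \<le> M \<longrightarrow> 0 < x \<longrightarrow> x \<le> X \<longrightarrow>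
    norm (mellin_kernel s x (Complex c t)) \<le> C * exp (- \<bar>t\<bar>)"
proof -
  have r: "3/2 < pi / 2" using pi_gt3 by simp
  obtain C1 where C1: "\<And>z. c + 1/2 \<le> Re z \<Longrightarrow> Re z \<le> c + 1/2 \<Longrightarrow> norm (Gamma z) \<le> C1 * exp (- (3/2) * \<bar>Im z\<bar>)"
  proof -
    have "0 < c + 1/2" using c by simp
    from norm_Gamma_right_strip[OF this r, of "c + 1/2"] show ?thesis using that by blast
  qed
  obtain C2 where C2: "\<And>z. 1 \<le> Re z \<Longrightarrow> Re z \<le> B + 2 \<Longrightarrow> norm (Gamma z) \<le> C2 * exp (- (3/2) * \<bar>Im z\<bar>)"
    using norm_Gamma_right_strip[OF zero_less_one r, of "B + 2"] by blast
  have "norm (mellin_kernel s x (Complex c t)) \<le> ((2 * C1) * C2 * 2 * exp (4 * M) * X powr (-c)) * exp (- \<bar>t\<bar>)"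
    if s: "0 < Re s" "Re s \<le> B" "\<bar>Im s\<bar> \<le> M" "0 < x" "x \<le> X" for s x t
  proof -
    define w where "w = Complex c t"
    have "norm (mellin_kernel s x w) \<le> (2 * C1) * C2 * 2 * exp (4 * M) * X powr (-c) * exp (- \<bar>Im w\<bar>)"
    proof (rule kernel_bound_aux)
      have nI: "w - 1/2 \<notin> \<int>\<^sub>\<le>\<^sub>0"
      proof
        assume "w - 1/2 \<in> \<int>\<^sub>\<le>\<^sub>0"
        then obtain n where "w - 1/2 = of_int n" by (auto elim!: nonpos_Ints_cases)
        then have "Re (w - 1/2) = real_of_int n" by simp
        then have "real_of_int n = c - 1/2" by (simp add: w_def)
        then have "real_of_int n > -1" "real_of_int n < 0" using c by auto
        then show False by simp
      qed
      then have "Gamma (w + 1/2) = (w - 1/2) * Gamma (w - 1/2)"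
        using Gamma_plus1[of "w - 1/2"] by (simp add: algebra_simps)
      then have eq: "norm (Gamma (w + 1/2)) = norm (w - 1/2) * norm (Gamma (w - 1/2))"
        by (simp add: norm_mult)
      \<comment> \<open>Re (w - 1/2) is negative, so the right strip estimate applies to Gamma(w +
        1/2) instead; dividing by w - 1/2, of modulus at least 1/2, produces the factor 2.\<close>
      have "1/2 \<le> norm (w - 1/2)"
        using abs_Re_le_cmod[of "w - 1/2"] c by (simp add: w_def)
      then have "1/2 * norm (Gamma (w - 1/2)) \<le> norm (Gamma (w + 1/2))"
        unfolding eq by (intro mult_right_mono) auto
      also have "norm (Gamma (w + 1/2)) \<le> C1 * exp (- (3/2) * \<bar>Im w\<bar>)"
        using C1[of "w + 1/2"] by (simp add: w_def)
      finally show "norm (Gamma (w - 1/2)) \<le> (2 * C1) * exp (- (3/2) * \<bar>Im w\<bar>)" by simp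
      show "norm (Gamma (1 + s - w)) \<le> C2 * exp (- (3/2) * \<bar>Im (1 + s - w)\<bar>)"
        by (rule C2) (use s c in \<open>auto simp: w_def\<close>)
      have "\<bar>pi * c / 2\<bar> = pi / 2 * (- c)" using c by (simp add: abs_if mult_pos_neg)
      also have "\<dots> \<le> pi / 2 * (1/2)" using c by (intro mult_left_mono) auto
      finally have "\<bar>pi * c / 2\<bar> \<le> pi / 4" by simp
      then have "norm (tan (of_real pi * w / 2)) \<le> 1" by (intro norm_tan_le_1) (simp add: w_def)
      then show "norm (tan (of_real pi * w / 2)) \<le> 2" by simp
      show "x powr (- Re w) \<le> X powr (- c)"
        using s c by (auto simp: w_def intro!: powr_mono2)
    qed (use s in auto)
    then show ?thesis by (simp add: w_def)
  qed
  then show ?thesis by blast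
qed

text \<open>The threshold 1 + |Im s| keeps both Gamma arguments at height at least 1, away from
  their poles, and likewise w away from the poles of the tangent.\<close>

lemma kernel_bound_strip:
  assumes "x > 0"
  shows "\<exists>C. \<forall>w. A \<le> Re w \<longrightarrow> Re w \<le> B \<longrightarrow> 1 + \<bar>Im s\<bar> \<le> \<bar>Im w\<bar> \<longrightarrow>
    norm (mellin_kernel s x w) \<le> C * exp (- \<bar>Im w\<bar>)"
proof -
  have r: "3/2 < pi / 2" using pi_gt3 by simp
  obtain C1 where C1: "\<And>z. A - 1/2 \<le> Re z \<Longrightarrow> Re z \<le> B - 1/2 \<Longrightarrow> 1 \<le> \<bar>Im z\<bar> \<Longrightarrow>
      norm (Gamma z) \<le> C1 * exp (- (3/2) * \<bar>Im z\<bar>)"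
    using norm_Gamma_strip[OF r, of "A - 1/2" "B - 1/2"] by blast
  obtain C2 where C2: "\<And>z. 1 + Re s - B \<le> Re z \<Longrightarrow> Re z \<le> 1 + Re s - A \<Longrightarrow> 1 \<le> \<bar>Im z\<bar> \<Longrightarrow>
      norm (Gamma z) \<le> C2 * exp (- (3/2) * \<bar>Im z\<bar>)"
    using norm_Gamma_strip[OF r, of "1 + Re s - B" "1 + Re s - A"] by blast
  have "norm (mellin_kernel s x w) \<le> C1 * C2 * 2 * exp (4 * \<bar>Im s\<bar>) * (x powr (- A) + x powr (- B)) * exp (- \<bar>Im w\<bar>)"
    if w: "A \<le> Re w" "Re w \<le> B" "1 + \<bar>Im s\<bar> \<le> \<bar>Im w\<bar>" for w
  proof (rule kernel_bound_aux)
    show "norm (Gamma (w - 1/2)) \<le> C1 * exp (- (3/2) * \<bar>Im w\<bar>)"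
      using C1[of "w - 1/2"] w by simp
    show "norm (Gamma (1 + s - w)) \<le> C2 * exp (- (3/2) * \<bar>Im (1 + s - w)\<bar>)"
      by (rule C2) (use w in auto)
    have "1 * 1 \<le> (pi / 2) * \<bar>Im w\<bar>" using w pi_gt3 by (intro mult_mono) auto
    then show "norm (tan (of_real pi * w / 2)) \<le> 2"
      by (intro norm_tan_le_2) (simp add: abs_mult)
    \<comment> \<open>A power of x is monotone in its exponent, so on the strip it is at most the
      sum of its two end values, for x below as well as above 1.\<close>
    show "x powr (- Re w) \<le> x powr (- A) + x powr (- B)"
    proof (cases "x \<ge> 1")
      case True
      then have "x powr (- Re w) \<le> x powr (- A)" using w by (intro powr_mono) auto
      then show ?thesis by (simp add: add_increasing2)
    next
      case False
      then have "x powr (- Re w) \<le> x powr (- B)" using w assms by (intro powr_mono') auto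
      then show ?thesis by (simp add: add_increasing)
    qed
  qed (use assms in auto)
  then show ?thesis by blast
qed

section \<open>Poles, integrability and parameter dependence of the kernel\<close>

lemma cos_half_pi_eq_0_iff: "cos (of_real pi * w / 2) = 0 \<longleftrightarrow> (\<exists>n::int. odd n \<and> w = of_int n)"
  for w :: complex
proof
  assume "cos (of_real pi * w / 2) = 0"
  then obtain n :: int where "of_real pi * w / 2 = of_real (n * pi) + of_real pi / 2"
    using cos_eq_0 by blast
  then have "of_real pi * w = of_real pi * of_int (2 * n + 1)" by (simp add: field_simps)
  then have "w = of_int (2 * n + 1)" by (subst (asm) mult_cancel_left) simp
  then show "\<exists>n::int. odd n \<and> w = of_int n" by (intro exI[of _ "2 * n + 1"]) simp
next
  assume "\<exists>n::int. odd n \<and> w = of_int n"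
  then obtain n k :: int where "w = of_int n" "n = 2 * k + 1" by (auto elim!: oddE)
  then have "of_real pi * w / 2 = of_real (k * pi) + of_real pi / 2" by (simp add: field_simps)
  then show "cos (of_real pi * w / 2) = 0" using cos_eq_0 by blast
qed

lemma kernel_holomorphic:
  assumes "x > 0"
    and "\<And>w. w \<in> A \<Longrightarrow> w - 1/2 \<notin> \<int>\<^sub>\<le>\<^sub>0"
    and "\<And>w. w \<in> A \<Longrightarrow> 1 + s - w \<notin> \<int>\<^sub>\<le>\<^sub>0"
    and "\<And>w n. w \<in> A \<Longrightarrow> odd n \<Longrightarrow> w \<noteq> of_int n"
  shows "mellin_kernel s x holomorphic_on A"
  unfolding mellin_kernel_def tan_def using assms
  by (intro holomorphic_intros) (auto simp: cos_half_pi_eq_0_iff complex_nonpos_Reals_iff)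

lemma notin_nonpos_Ints_of_Re: "Re z > 0 \<Longrightarrow> z \<notin> \<int>\<^sub>\<le>\<^sub>0"
  by (auto elim!: nonpos_Ints_cases)

lemma not_Ints_of_Re:
  assumes "of_int n < Re z" "Re z < of_int n + 1"
  shows "z \<notin> \<int>"
proof
  assume "z \<in> \<int>"
  then obtain m where "z = of_int m" by (auto elim: Ints_cases)
  then have "real_of_int n < of_int m" "real_of_int m < of_int n + 1" using assms by auto
  then have "n < m" "m < n + 1" by linarith+
  then show False by simp
qed

lemma kernel_base_regular:
  assumes "- 1/2 < Re w" "Re w < 0" "Re s > 0"
  shows "w - 1/2 \<notin> \<int>\<^sub>\<le>\<^sub>0" "1 + s - w \<notin> \<int>\<^sub>\<le>\<^sub>0" "w \<noteq> of_int n" "w \<notin> \<int>"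
proof -
  show nI: "w \<notin> \<int>" by (rule not_Ints_of_Re[of "-1"]) (use assms in auto)
  then show "w \<noteq> of_int n" by auto
  have "w - 1/2 \<notin> \<int>" by (rule not_Ints_of_Re[of "-1"]) (use assms in auto)
  then show "w - 1/2 \<notin> \<int>\<^sub>\<le>\<^sub>0" by (auto simp: nonpos_Ints_def)
  show "1 + s - w \<notin> \<int>\<^sub>\<le>\<^sub>0" by (rule notin_nonpos_Ints_of_Re) (use assms in auto)
qed

lemma kernel_base_continuous:
  assumes "- 1/2 < c" "c < 0" "Re s > 0" "x > 0"
  shows "continuous_on UNIV (\<lambda>t. mellin_kernel s x (Complex c t))"
proof (rule continuous_on_vertical_line)
  show "mellin_kernel s x holomorphic_on {w. Re w = c}"
    using assms kernel_base_regular[of _ s] by (intro kernel_holomorphic) auto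
qed auto

lemma kernel_base_integrable:
  assumes "- 1/2 < c" "c < 0" "Re s > 0" "x > 0"
  shows "integrable lborel (\<lambda>t. mellin_kernel s x (Complex c t))"
proof -
  obtain C where "\<And>t. norm (mellin_kernel s x (Complex c t)) \<le> C * exp (- \<bar>t\<bar>)"
    using kernel_bound_base[OF assms(1,2), of "Re s" "\<bar>Im s\<bar>" x] assms by blast
  then show ?thesis by (intro integrable_vertical_line kernel_base_continuous assms)
qed

text \<open>Joint continuity by dominated convergence. It serves the limit of x to 1 with s fixed
  and the limit of s to an integer with x fixed.\<close>

lemma kernel_integral_tendsto:
  assumes c: "- 1/2 < c" "c < 0" and S: "S \<longlonglongrightarrow> s" "\<And>n. Re (S n) > 0" "Re s > 0"
    and X: "X \<longlonglongrightarrow> x" "\<And>n. X n > 0" "x > 0"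
  shows "(\<lambda>n. LINT t|lborel. mellin_kernel (S n) (X n) (Complex c t)) \<longlonglongrightarrow> (LINT t|lborel. mellin_kernel s x (Complex c t))"
proof -
  obtain B where B: "\<And>n. norm (S n) \<le> B"
    using S(1) convergent_imp_Bseq[of S] by (auto simp: convergent_def Bseq_def)
  obtain B' where B': "\<And>n. norm (X n) \<le> B'"
    using X(1) convergent_imp_Bseq[of X] by (auto simp: convergent_def Bseq_def)
  obtain C where C: "\<And>s x t. 0 < Re s \<Longrightarrow> Re s \<le> B \<Longrightarrow> \<bar>Im s\<bar> \<le> B \<Longrightarrow> 0 < x \<Longrightarrow> x \<le> B' \<Longrightarrow>
    norm (mellin_kernel s x (Complex c t)) \<le> C * exp (- \<bar>t\<bar>)"
    using kernel_bound_base[OF c, of B B B'] by blast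
  show ?thesis
  proof (rule integral_dominated_convergence[where w = "\<lambda>t. C * exp (- \<bar>t\<bar>)"])
    show "(\<lambda>t. mellin_kernel s x (Complex c t)) \<in> borel_measurable lborel"
      using borel_measurable_continuous_onI[OF kernel_base_continuous[OF c S(3) X(3)]] by simp
    show "(\<lambda>t. mellin_kernel (S n) (X n) (Complex c t)) \<in> borel_measurable lborel" for n
      using borel_measurable_continuous_onI[OF kernel_base_continuous[OF c S(2) X(2)]] by simp
    show "integrable lborel (\<lambda>t. C * exp (- \<bar>t\<bar>))"
      by (intro integrable_mult_right integrable_exp_neg_abs)
    show "AE t in lborel. norm (mellin_kernel (S n) (X n) (Complex c t)) \<le> C * exp (- \<bar>t\<bar>)" for n
      using B[of n] B'[of n] S(2)[of n] X(2)[of n] complex_Re_le_cmod[of "S n"] abs_Im_le_cmod[of "S n"]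
      by (intro AE_I2 C) auto
    show "AE t in lborel. (\<lambda>n. mellin_kernel (S n) (X n) (Complex c t)) \<longlonglongrightarrow> mellin_kernel s x (Complex c t)"
    proof (intro AE_I2)
      fix t
      have "1 + s - Complex c t \<notin> \<int>\<^sub>\<le>\<^sub>0" by (rule notin_nonpos_Ints_of_Re) (use c S in auto)
      moreover have "complex_of_real x \<notin> \<real>\<^sub>\<le>\<^sub>0" using X by (simp add: complex_nonpos_Reals_iff)
      ultimately show "(\<lambda>n. mellin_kernel (S n) (X n) (Complex c t)) \<longlonglongrightarrow> mellin_kernel s x (Complex c t)"
        unfolding mellin_kernel_def by (intro tendsto_intros S X) auto
    qed
  qed
qed

text \<open>Duplication at w - 1/2 relates Gamma(2 w - 1) to Gamma(w - 1/2) Gamma(w), and reflection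
  removes Gamma(w) together with Gamma(1 - w). The factor 4^w from duplication, called
  \<open>E\<close> in the proof, cancels against (4 x)^(-w).\<close>

lemma integrand_eq_kernel:
  assumes w: "- 1/2 < Re w" "Re w < 0" and "x > 0"
  shows "integrand s x (2 * w) = of_real (sqrt pi) / 8 * mellin_kernel s x w"
proof -
  have nI: "w - 1/2 \<notin> \<int>\<^sub>\<le>\<^sub>0" "w \<notin> \<int>"
    using kernel_base_regular[of w 1] w by auto
  then have nI': "w - 1/2 + 1/2 \<notin> \<int>\<^sub>\<le>\<^sub>0" by (auto simp: nonpos_Ints_def)
  have cnz: "cos (of_real pi * w / 2) \<noteq> 0" using nI(2) by (auto simp: cos_half_pi_eq_0_iff)
  have snz: "sin (of_real pi * w / 2) \<noteq> 0"
  proof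
    assume "sin (of_real pi * w / 2) = 0"
    then obtain n :: int where "of_real pi * w / 2 = of_real (n * pi)"
      using sin_eq_0 by blast
    then have "of_real pi * w = of_real pi * of_int (2 * n)" by (simp add: field_simps)
    then have "w = of_int (2 * n)" by (subst (asm) mult_cancel_left) simp
    then show False using nI(2) by simp
  qed
  define E where "E = exp (2 * w * of_real (ln 2))"
  have E: "E \<noteq> 0" by (simp add: E_def)
  have leg: "Gamma (w - 1/2) * Gamma w = 4 / E * of_real (sqrt pi) * Gamma (2 * w - 1)"
  proof -
    have "(1 - 2 * (w - 1/2)) * of_real (ln 2) = of_real (ln 4) - 2 * w * complex_of_real (ln 2)"
      using ln_realpow[of 2 2] by (simp add: algebra_simps)
    then have "exp ((1 - 2 * (w - 1/2)) * of_real (ln 2)) = 4 / E"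
      by (simp add: exp_diff E_def exp_of_real)
    then show ?thesis
      using Gamma_legendre_duplication[OF nI(1) nI'] by (simp add: algebra_simps)
  qed
  have refl: "Gamma w * Gamma (1 - w) = of_real pi / (2 * sin (of_real pi * w / 2) * cos (of_real pi * w / 2))"
    using Gamma_reflection_complex[of w] sin_double[of "of_real pi * w / 2"] by simp
  have pw: "of_real (4 * x) powr (- w) = complex_of_real x powr (- w) / E"
  proof -
    have "ln (4 * x) = 2 * ln 2 + ln x" using \<open>x > 0\<close> ln_realpow[of 2 2] by (simp add: ln_mult)
    then have "- w * of_real (ln (4 * x)) = - w * of_real (ln x) - 2 * w * complex_of_real (ln 2)"
      by (simp add: algebra_simps)
    moreover have pe: "complex_of_real y powr (- w) = exp (- w * of_real (ln y))" if "y > 0" for y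
      using that by (simp add: powr_def Ln_of_real)
    ultimately show ?thesis using pe[of "4 * x"] pe[of x] \<open>x > 0\<close>
      by (simp only: E_def exp_diff)
  qed
  have G: "Gamma (2 * w - 1) * Gamma (1 - w) = Gamma (w - 1/2) * (E * of_real (sqrt pi))
      / (8 * sin (of_real pi * w / 2) * cos (of_real pi * w / 2))"
  proof -
    have "4 / E * of_real (sqrt pi) * (Gamma (2 * w - 1) * Gamma (1 - w)) = (Gamma (w - 1/2) * Gamma w) * Gamma (1 - w)"
      unfolding leg by simp
    also have "\<dots> = Gamma (w - 1/2) * (Gamma w * Gamma (1 - w))" by simp
    also have "\<dots> = Gamma (w - 1/2) * (of_real (sqrt pi) * of_real (sqrt pi)
        / (2 * sin (of_real pi * w / 2) * cos (of_real pi * w / 2)))"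
      unfolding refl by (simp flip: of_real_mult)
    finally show ?thesis using E snz cnz by (simp add: field_simps)
  qed
  have "integrand s x (2 * w) = (Gamma (2 * w - 1) * Gamma (1 - w)) * Gamma (1 - w + s)
      * (sin (of_real pi * w / 2))\<^sup>2 * sin (of_real pi * w / 2 - of_real pi * s / 2) * of_real (4 * x) powr (- w)"
    unfolding integrand_def by (simp add: algebra_simps)
  also have "\<dots> = of_real (sqrt pi) / 8 * mellin_kernel s x w"
    unfolding G pw mellin_kernel_def tan_def using E snz cnz
    by (simp add: field_simps power2_eq_square)
  finally show ?thesis .
qed

lemma integrand_line:
  assumes "- 1 < lam" "lam < 0" "x > 0"
  shows "integrand s x (Complex lam t) = of_real (sqrt pi) / 8 * mellin_kernel s x (Complex (lam / 2) (t / 2))"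
proof -
  have "Complex lam t = 2 * Complex (lam / 2) (t / 2)" by (simp add: complex_eq_iff)
  then show ?thesis using assms by (simp only:, subst integrand_eq_kernel) auto
qed

lemma vertical_integrable_integrand:
  assumes "- 1 < lam" "lam < 0" "x > 0" "Re s > 0"
  shows "vertical_integrable lam (integrand s x)"
proof -
  define g where "g = (\<lambda>t. mellin_kernel s x (Complex (lam / 2) t))"
  have "integrable lborel g" unfolding g_def using assms by (intro kernel_base_integrable) auto
  from lborel_integrable_real_affine[OF this, of "1/2" 0]
  have "integrable lborel (\<lambda>t. g (t / 2))" by simp
  then show ?thesis
    unfolding vertical_integrable_def using assms by (simp add: integrand_line g_def)
qed

text \<open>The constant is the product of 1 / (2 pi i), of i from dz = i dt, of 2 from the scaling
  z = 2 w, and of sqrt(pi) / 8 from the reduction of the integrand.\<close>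

lemma I_fun_eq_kernel_integral:
  assumes "- 1 < lam" "lam < 0" "x > 0"
  shows "I_fun lam s x = of_real (sqrt pi / (8 * pi)) * (LINT t|lborel. mellin_kernel s x (Complex (lam / 2) t))"
proof -
  define g where "g = (\<lambda>t. mellin_kernel s x (Complex (lam / 2) t))"
  have "(LINT t|lborel. g (t / 2)) = 2 * (LINT t|lborel. g t)"
    using lborel_integral_real_affine[of 2 "\<lambda>t. g (t / 2)" 0] by (simp add: scaleR_conv_of_real)
  moreover have "vertical_integral lam (integrand s x) = \<i> * (of_real (sqrt pi) / 8 * (LINT t|lborel. g (t / 2)))"
    unfolding vertical_integral_def using assms by (simp add: integrand_line g_def)
  ultimately show ?thesis unfolding I_fun_def by (simp add: g_def field_simps)
qed

lemma I_fun_tendsto: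
  assumes "- 1 < lam" "lam < 0" and "S \<longlonglongrightarrow> s" "\<And>n. Re (S n) > 0" "Re s > 0"
    and "X \<longlonglongrightarrow> x" "\<And>n. X n > 0" "x > 0"
  shows "(\<lambda>n. I_fun lam (S n) (X n)) \<longlonglongrightarrow> I_fun lam s x"
  unfolding I_fun_eq_kernel_integral[OF assms(1,2,7)] I_fun_eq_kernel_integral[OF assms(1,2,8)]
  using assms by (intro tendsto_intros kernel_integral_tendsto) auto

text \<open>The correction factor tends to 1, so the ratio of consecutive terms is eventually below
  (1 + rho) / 2 < 1, and \<open>K\<close> is even summable.\<close>

lemma ratio_bound_tendsto_0:
  fixes K :: "nat \<Rightarrow> real"
  assumes "\<rho> < 1" "0 \<le> \<rho>" "\<And>n. 0 \<le> K n"
    and "\<And>n. K (Suc n) \<le> \<rho> * (1 + B / (2 * real n + 1))\<^sup>2 * K n"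
  shows "K \<longlonglongrightarrow> 0"
proof -
  have "(\<lambda>n. \<rho> * (1 + B / (2 * real n + 1))\<^sup>2) \<longlonglongrightarrow> \<rho> * (1 + 0)\<^sup>2"
    by (intro tendsto_intros) real_asymp
  then have "\<forall>\<^sub>F n in sequentially. \<rho> * (1 + B / (2 * real n + 1))\<^sup>2 < (1 + \<rho>) / 2"
    using assms(1) by (intro order_tendstoD) auto
  then obtain N where N: "\<And>n. n \<ge> N \<Longrightarrow> \<rho> * (1 + B / (2 * real n + 1))\<^sup>2 < (1 + \<rho>) / 2"
    unfolding eventually_sequentially by blast
  have "summable K"
  proof (rule summable_ratio_test[where c = "(1 + \<rho>) / 2" and N = N])
    fix n assume "n \<ge> N"
    have "K (Suc n) \<le> (1 + \<rho>) / 2 * K n"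
      using assms(4)[of n] mult_right_mono[OF less_imp_le[OF N[OF \<open>n \<ge> N\<close>]] assms(3)[of n]] by linarith
    then show "norm (K (Suc n)) \<le> (1 + \<rho>) / 2 * norm (K n)" using assms(3) by simp
  qed (use assms in auto)
  then show ?thesis by (rule summable_LIMSEQ_zero)
qed

section \<open>Translation by two and residues of the reduced integrand\<close>

text \<open>The limit c may be 0, so removable singularities can be kept among the points of
  \<open>P\<close>.\<close>

lemma residue_strip_eqI:
  assumes "f holomorphic_on {z. a < Re z \<and> Re z < b} - P" "finite P" "p \<in> P" "a < Re p" "Re p < b"
    and "((\<lambda>z. f z * (z - p)) \<longlongrightarrow> c) (at p)"
  shows "residue f p = c"
proof -
  have "open {z. a < Re z \<and> Re z < b}"
    by (simp add: Collect_conj_eq open_Int open_halfspace_Re_gt open_halfspace_Re_lt)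
  then show ?thesis
    using assms
    by (intro residue_simple'[where s = "{z. a < Re z \<and> Re z < b} - (P - {p})"]
        holomorphic_on_subset[OF assms(1)] open_Diff finite_imp_closed) auto
qed

lemma of_real_powr_add_nat:
  assumes "x > 0"
  shows "complex_of_real x powr (z + of_nat n) = of_real x powr z * of_real x ^ n"
  using assms by (simp add: powr_def exp_add distrib_right exp_of_nat_mult)

lemma of_real_powr_diff_nat:
  assumes "x > 0"
  shows "complex_of_real x powr (z - of_nat n) = of_real x powr z * of_real (1 / x) ^ n"
proof -
  have "exp (of_nat n * Ln (complex_of_real x)) = of_real x ^ n"
    using assms by (simp add: exp_of_nat_mult)
  then show ?thesis
    using assms by (simp add: powr_def exp_diff left_diff_distrib power_one_over)
qed

lemma sin_plus_minus_pi: "sin (z + of_real pi) = - sin z" "sin (z - of_real pi) = - sin z"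
    "tan (z + of_real pi) = tan z" "tan (z - of_real pi) = tan z" for z :: complex
  by (simp_all add: tan_def sin_add cos_add sin_diff cos_diff)

lemma Gamma_plus2:
  fixes z :: complex
  assumes "z \<notin> \<int>\<^sub>\<le>\<^sub>0"
  shows "Gamma (z + 2) = z * (z + 1) * Gamma z"
proof -
  have "z + 1 \<notin> \<int>\<^sub>\<le>\<^sub>0" using assms plus_one_in_nonpos_Ints_imp by blast
  then show ?thesis using Gamma_plus1[of "z + 1"] Gamma_plus1[OF assms] by (simp add: add.assoc)
qed

lemma kernel_shift_left:
  assumes "x > 0" "w - 5/2 \<notin> \<int>\<^sub>\<le>\<^sub>0" "1 + s - w \<notin> \<int>\<^sub>\<le>\<^sub>0"
  shows "mellin_kernel s x (w - 2) = - (of_real x ^ 2 * ((1 + s - w) / (w - 3/2)) * ((2 + s - w) / (w - 5/2)) * mellin_kernel s x w)"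
proof -
  have n2: "w - 3/2 \<notin> \<int>\<^sub>\<le>\<^sub>0"
    using assms(2) plus_one_in_nonpos_Ints_imp[of "w - 5/2"] by fastforce
  then have nz: "w - 3/2 \<noteq> 0" "w - 5/2 \<noteq> 0" using assms(2) zero_in_nonpos_Ints by metis+
  have G1: "Gamma (w - 1/2) = (w - 5/2) * (w - 3/2) * Gamma (w - 5/2)"
    using Gamma_plus2[OF assms(2)] by (simp add: algebra_simps)
  have G2: "Gamma (1 + s - (w - 2)) = (1 + s - w) * (2 + s - w) * Gamma (1 + s - w)"
    using Gamma_plus2[OF assms(3)] by (simp add: algebra_simps)
  have t: "tan (of_real pi * (w - 2) / 2) = tan (of_real pi * w / 2)"
    using sin_plus_minus_pi(4)[of "of_real pi * w / 2"] by (simp add: field_simps)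
  have si: "sin (of_real pi * (w - 2 - s) / 2) = - sin (of_real pi * (w - s) / 2)"
    using sin_plus_minus_pi(2)[of "of_real pi * (w - s) / 2"] by (simp add: field_simps)
  have pw: "complex_of_real x powr (- (w - 2)) = of_real x powr (- w) * of_real x ^ 2"
    using of_real_powr_add_nat[OF assms(1), of "- w" 2] by (simp add: algebra_simps)
  have e: "w - 2 - 1/2 = w - 5/2" by simp
  \<comment> \<open>The field identity is stated for free variables, so that simplification cannot
    rewrite the Gamma and trigonometric terms that are put in their place.\<close>
  have alg: "g * (q1 * q2 * G) * T * (- S) * (P * X) = - (X * (q1 / u) * (q2 / v) * (v * u * g * G * T * S * P))"
    if "u \<noteq> 0" "v \<noteq> 0" for g q1 q2 G T S P X u v :: complex
    using that by (simp add: field_simps)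
  show ?thesis
    unfolding mellin_kernel_def t si pw G1 G2 e by (rule alg[OF nz])
qed

lemma kernel_shift_right:
  assumes "x > 0" "w - 1/2 \<notin> \<int>\<^sub>\<le>\<^sub>0" "s - 1 - w \<notin> \<int>\<^sub>\<le>\<^sub>0"
  shows "mellin_kernel s x (w + 2) = - (of_real (1 / x) ^ 2 * ((w - 1/2) / (s - w)) * ((w + 1/2) / (s - 1 - w)) * mellin_kernel s x w)"
proof -
  have n2: "s - w \<notin> \<int>\<^sub>\<le>\<^sub>0"
    using assms(3) plus_one_in_nonpos_Ints_imp[of "s - 1 - w"] by fastforce
  then have nz: "s - w \<noteq> 0" "s - 1 - w \<noteq> 0" using assms(3) zero_in_nonpos_Ints by metis+
  have G1: "Gamma (w + 2 - 1/2) = (w - 1/2) * (w + 1/2) * Gamma (w - 1/2)"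
    using Gamma_plus2[OF assms(2)] by (simp add: algebra_simps)
  have G2: "Gamma (1 + s - w) = (s - 1 - w) * (s - w) * Gamma (s - 1 - w)"
    using Gamma_plus2[OF assms(3)] by (simp add: algebra_simps)
  have t: "tan (of_real pi * (w + 2) / 2) = tan (of_real pi * w / 2)"
    using sin_plus_minus_pi(3)[of "of_real pi * w / 2"] by (simp add: field_simps)
  have si: "sin (of_real pi * (w + 2 - s) / 2) = - sin (of_real pi * (w - s) / 2)"
    using sin_plus_minus_pi(1)[of "of_real pi * (w - s) / 2"] by (simp add: field_simps)
  have pw: "complex_of_real x powr (- (w + 2)) = of_real x powr (- w) * of_real (1 / x) ^ 2"
    using of_real_powr_diff_nat[OF assms(1), of "- w" 2] by (simp add: algebra_simps)
  have e: "1 + s - (w + 2) = s - 1 - w" by simp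
  have alg: "q1 * q2 * g * G * T * (- S) * (P * X) = - (X * (q1 / u) * (q2 / v) * (g * (v * u * G) * T * S * P))"
    if "u \<noteq> 0" "v \<noteq> 0" for g q1 q2 G T S P X u v :: complex
    using that by (simp add: field_simps)
  show ?thesis
    unfolding mellin_kernel_def t si pw G1 G2 e by (rule alg[OF nz])
qed

text \<open>In all four uses q + u is the constant s - 1/2, so q / u is -1 up to an error |s - 1/2|
  / |u|. This makes the rational factors of a shift by 2 tend to modulus 1 uniformly along vertical
  lines.\<close>

lemma norm_quotient_bound:
  fixes u q :: complex
  assumes "norm (q + u) \<le> B" "0 < d" "d \<le> norm u"
  shows "norm (q / u) \<le> 1 + B / d"
proof -
  have "norm q \<le> norm (q + u) + norm u" by (metis add_diff_cancel_right' norm_triangle_ineq4)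
  then have "norm q / norm u \<le> (B + norm u) / norm u" using assms by (intro divide_right_mono) auto
  also have "\<dots> = 1 + B / norm u" using less_le_trans[OF assms(2,3)] by (simp add: add_divide_distrib)
  also have "\<dots> \<le> 1 + B / d"
  proof -
    have "0 \<le> B" using order_trans[OF norm_ge_zero assms(1)] .
    then have "B / norm u \<le> B / d" using assms by (intro frac_le) simp_all
    then show ?thesis by simp
  qed
  finally show ?thesis by (simp add: norm_divide)
qed

lemma kernel_step_left:
  assumes "x > 0" "Re s > 0" "- 1/2 < c" "c < 0" "Re w = c - 2 * real n"
  shows "norm (mellin_kernel s x (w - 2)) \<le> x\<^sup>2 * (1 + norm (s - 1/2) / (2 * real n + 1))\<^sup>2 * norm (mellin_kernel s x w)"
proof -
  define D where "D = 1 + norm (s - 1/2) / (2 * real n + 1)"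
  have "w - 5/2 \<notin> \<int>"
    by (rule not_Ints_of_Re[of "- 2 * int n - 3"]) (use assms in auto)
  then have "w - 5/2 \<notin> \<int>\<^sub>\<le>\<^sub>0" by (auto simp: nonpos_Ints_def)
  moreover have "1 + s - w \<notin> \<int>\<^sub>\<le>\<^sub>0" by (rule notin_nonpos_Ints_of_Re) (use assms in auto)
  ultimately have "norm (mellin_kernel s x (w - 2))
      = x\<^sup>2 * norm ((1 + s - w) / (w - 3/2)) * norm ((2 + s - w) / (w - 5/2)) * norm (mellin_kernel s x w)"
    by (subst kernel_shift_left[OF assms(1)]) (simp_all only: norm_mult norm_minus_cancel norm_power norm_of_real power2_abs simp_thms)
  also have "\<dots> \<le> x\<^sup>2 * D * D * norm (mellin_kernel s x w)"
  proof -
    have D0: "D \<ge> 0" by (simp add: D_def)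
    \<comment> \<open>Since c < 0, the real part c - 2 n - 3/2 of the denominator has modulus above
      2 n + 1; the second denominator is larger still.\<close>
    have "norm ((1 + s - w) / (w - 3/2)) \<le> D" unfolding D_def
      using abs_Re_le_cmod[of "w - 3/2"] assms
      by (intro norm_quotient_bound) (auto simp: algebra_simps)
    moreover have "norm ((2 + s - w) / (w - 5/2)) \<le> D" unfolding D_def
      using abs_Re_le_cmod[of "w - 5/2"] assms
      by (intro norm_quotient_bound) (auto simp: algebra_simps)
    ultimately show ?thesis using D0 by (intro mult_mono mult_nonneg_nonneg) auto
  qed
  finally show ?thesis by (simp add: D_def power2_eq_square mult_ac)
qed

text \<open>The lines start at Re s + \<delta> + 2: without the extra 2, Re (w - 1/2) could be
  negative and the real part of s - w would have modulus below 2 n + 1.\<close>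

lemma kernel_step_right:
  assumes "x > 0" "Re s > 0" "0 < \<delta>" "\<delta> < 1" "Re w = Re s + \<delta> + 2 * (real n + 1)"
  shows "norm (mellin_kernel s x (w + 2)) \<le> (1 / x)\<^sup>2 * (1 + norm (s - 1/2) / (2 * real n + 1))\<^sup>2 * norm (mellin_kernel s x w)"
proof -
  define D where "D = 1 + norm (s - 1/2) / (2 * real n + 1)"
  have "s - 1 - w \<notin> \<int>"
    by (rule not_Ints_of_Re[of "- 2 * int n - 4"]) (use assms in auto)
  then have "s - 1 - w \<notin> \<int>\<^sub>\<le>\<^sub>0" by (auto simp: nonpos_Ints_def)
  moreover have "w - 1/2 \<notin> \<int>\<^sub>\<le>\<^sub>0" by (rule notin_nonpos_Ints_of_Re) (use assms in auto)
  ultimately have "norm (mellin_kernel s x (w + 2))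
      = (1 / x)\<^sup>2 * norm ((w - 1/2) / (s - w)) * norm ((w + 1/2) / (s - 1 - w)) * norm (mellin_kernel s x w)"
    by (subst kernel_shift_right[OF assms(1)]) (simp_all only: norm_mult norm_minus_cancel norm_power norm_of_real power2_abs simp_thms)
  also have "\<dots> \<le> (1 / x)\<^sup>2 * D * D * norm (mellin_kernel s x w)"
  proof -
    have D0: "D \<ge> 0" by (simp add: D_def)
    have "norm ((w - 1/2) / (s - w)) \<le> D" unfolding D_def
      using abs_Re_le_cmod[of "s - w"] assms
      by (intro norm_quotient_bound) (auto simp: algebra_simps)
    moreover have "norm ((w + 1/2) / (s - 1 - w)) \<le> D" unfolding D_def
      using abs_Re_le_cmod[of "s - 1 - w"] assms
      by (intro norm_quotient_bound) (auto simp: algebra_simps)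
    ultimately show ?thesis using D0 by (intro mult_mono mult_nonneg_nonneg) auto
  qed
  finally show ?thesis by (simp add: D_def power2_eq_square mult_ac)
qed

section \<open>Line integrals far to the left and far to the right\<close>

lemma kernel_line_integrable:
  assumes "x > 0" and "\<And>w. Re w = c \<Longrightarrow> w - 1/2 \<notin> \<int>\<^sub>\<le>\<^sub>0"
    and "\<And>w. Re w = c \<Longrightarrow> 1 + s - w \<notin> \<int>\<^sub>\<le>\<^sub>0" and "\<And>n. odd n \<Longrightarrow> c \<noteq> of_int n"
  shows "integrable lborel (\<lambda>t. mellin_kernel s x (Complex c t))"
proof -
  have hol: "mellin_kernel s x holomorphic_on {w. Re w = c}"
  proof (rule kernel_holomorphic)
    show "w \<noteq> of_int n" if "w \<in> {w. Re w = c}" "odd n" for w n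
      using assms(4)[OF that(2)] that(1) by auto
  qed (use assms in auto)
  have "continuous_on UNIV (\<lambda>t. mellin_kernel s x (Complex c t))"
    by (rule continuous_on_vertical_line[OF hol]) simp
  moreover obtain C where "\<And>w. c \<le> Re w \<Longrightarrow> Re w \<le> c \<Longrightarrow> 1 + \<bar>Im s\<bar> \<le> \<bar>Im w\<bar> \<Longrightarrow>
      norm (mellin_kernel s x w) \<le> C * exp (- \<bar>Im w\<bar>)"
    using kernel_bound_strip[OF assms(1), of c c s] by blast
  from this[of "Complex c _"] have "\<And>t. 1 + \<bar>Im s\<bar> \<le> \<bar>t\<bar> \<Longrightarrow> norm (mellin_kernel s x (Complex c t)) \<le> C * exp (- \<bar>t\<bar>)"
    by simp
  ultimately show ?thesis by (rule integrable_vertical_line)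
qed

text \<open>The pointwise comparison of consecutive lines integrates to a ratio bound for the L1
  norms, which dominate the integrals.\<close>

lemma line_integrals_tendsto_0:
  fixes f :: "nat \<Rightarrow> real \<Rightarrow> complex"
  assumes "\<And>n. integrable lborel (f n)" "0 \<le> \<rho>" "\<rho> < 1"
    and "\<And>n t. norm (f (Suc n) t) \<le> \<rho> * (1 + B / (2 * real n + 1))\<^sup>2 * norm (f n t)"
  shows "(\<lambda>n. LINT t|lborel. f n t) \<longlonglongrightarrow> 0"
proof -
  define K where "K = (\<lambda>n. LINT t|lborel. norm (f n t))"
  have "K (Suc n) \<le> \<rho> * (1 + B / (2 * real n + 1))\<^sup>2 * K n" for n
  proof -
    have "K (Suc n) \<le> (LINT t|lborel. \<rho> * (1 + B / (2 * real n + 1))\<^sup>2 * norm (f n t))"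
      unfolding K_def using assms by (intro integral_mono) auto
    then show ?thesis by (simp add: K_def)
  qed
  then have "K \<longlonglongrightarrow> 0"
    using assms(2,3) by (intro ratio_bound_tendsto_0[of \<rho> K B]) (auto simp: K_def)
  moreover have "\<forall>\<^sub>F n in sequentially. norm (LINT t|lborel. f n t) \<le> K n"
    unfolding K_def by (intro always_eventually allI integral_norm_bound)
  ultimately show ?thesis by (rule Lim_null_comparison[rotated])
qed

lemma left_lines_tendsto_0:
  assumes "0 < x" "x < 1" "Re s > 0" "- 1/2 < c" "c < 0"
  shows "(\<lambda>n. LINT t|lborel. mellin_kernel s x (Complex (c - 2 * real n) t)) \<longlonglongrightarrow> 0"
proof (rule line_integrals_tendsto_0)
  fix n
  show "integrable lborel (\<lambda>t. mellin_kernel s x (Complex (c - 2 * real n) t))"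
  proof (rule kernel_line_integrable)
    fix w assume w: "Re w = c - 2 * real n"
    have "w - 1/2 \<notin> \<int>" by (rule not_Ints_of_Re[of "- 2 * int n - 1"]) (use assms w in auto)
    then show "w - 1/2 \<notin> \<int>\<^sub>\<le>\<^sub>0" by (auto simp: nonpos_Ints_def)
    show "1 + s - w \<notin> \<int>\<^sub>\<le>\<^sub>0" by (rule notin_nonpos_Ints_of_Re) (use assms w in auto)
  next
    fix k :: int
    have "of_real (c - 2 * real n) \<notin> (\<int> :: complex set)"
      by (rule not_Ints_of_Re[of "- 2 * int n - 1"]) (use assms in auto)
    then show "c - 2 * real n \<noteq> of_int k" by (metis Ints_of_int of_real_of_int_eq)
  qed (use assms in auto)
next
  show "x\<^sup>2 < 1" using assms by (simp add: power_less_one_iff abs_square_less_1)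
next
  fix n t
  have "Complex (c - 2 * real (Suc n)) t = Complex (c - 2 * real n) t - 2"
    by (simp add: complex_eq_iff)
  then show "norm (mellin_kernel s x (Complex (c - 2 * real (Suc n)) t))
    \<le> x\<^sup>2 * (1 + norm (s - 1/2) / (2 * real n + 1))\<^sup>2 * norm (mellin_kernel s x (Complex (c - 2 * real n) t))"
    using kernel_step_left[of x s c "Complex (c - 2 * real n) t" n] assms by simp
qed auto

lemma right_lines_tendsto_0:
  assumes "1 < x" "Re s > 0" "0 < \<delta>" "\<delta> < 1" "\<And>n. odd n \<Longrightarrow> Re s + \<delta> \<noteq> of_int n"
  shows "(\<lambda>n. LINT t|lborel. mellin_kernel s x (Complex (Re s + \<delta> + 2 * (real n + 1)) t)) \<longlonglongrightarrow> 0"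
proof (rule line_integrals_tendsto_0)
  fix n
  show "integrable lborel (\<lambda>t. mellin_kernel s x (Complex (Re s + \<delta> + 2 * (real n + 1)) t))"
  proof (rule kernel_line_integrable)
    fix w assume w: "Re w = Re s + \<delta> + 2 * (real n + 1)"
    have "1 + s - w \<notin> \<int>" by (rule not_Ints_of_Re[of "- 2 * int n - 2"]) (use assms w in auto)
    then show "1 + s - w \<notin> \<int>\<^sub>\<le>\<^sub>0" by (auto simp: nonpos_Ints_def)
    show "w - 1/2 \<notin> \<int>\<^sub>\<le>\<^sub>0" by (rule notin_nonpos_Ints_of_Re) (use assms w in auto)
  next
    fix k :: int assume "odd k"
    then have "Re s + \<delta> \<noteq> of_int (k - 2 * (int n + 1))" by (intro assms) simp
    then show "Re s + \<delta> + 2 * (real n + 1) \<noteq> of_int k" by auto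
  qed (use assms in auto)
next
  show "(1 / x)\<^sup>2 < 1" using assms by (simp add: power_less_one_iff abs_square_less_1)
next
  fix n t
  have "Complex (Re s + \<delta> + 2 * (real (Suc n) + 1)) t = Complex (Re s + \<delta> + 2 * (real n + 1)) t + 2"
    by (simp add: complex_eq_iff)
  then show "norm (mellin_kernel s x (Complex (Re s + \<delta> + 2 * (real (Suc n) + 1)) t))
    \<le> (1 / x)\<^sup>2 * (1 + norm (s - 1/2) / (2 * real n + 1))\<^sup>2 * norm (mellin_kernel s x (Complex (Re s + \<delta> + 2 * (real n + 1)) t))"
    using kernel_step_right[of x s \<delta> "Complex (Re s + \<delta> + 2 * (real n + 1)) t" n] assms by simp
qed auto

section \<open>Residues at the three families of poles\<close>

lemma kernel_residue_Gamma1: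
  assumes "x > 0" "s + 1/2 + of_nat k \<notin> \<int>\<^sub>\<le>\<^sub>0"
  shows "((\<lambda>w. mellin_kernel s x w * (w - (1/2 - of_nat k))) \<longlongrightarrow>
     (-1) ^ k / fact k * Gamma (s + 1/2 + of_nat k) * tan (of_real pi * (1/2 - of_nat k) / 2)
      * sin (of_real pi * (1/2 - of_nat k - s) / 2) * of_real x powr (of_nat k - 1/2)) (at (1/2 - of_nat k))"
proof -
  define p :: complex where "p = 1/2 - of_nat k"
  have nI: "p \<notin> \<int>"
    by (rule not_Ints_of_Re[of "- int k"]) (auto simp: p_def)
  have "filterlim (\<lambda>w. w - 1/2) (at (- of_nat k)) (at p)"
    unfolding filterlim_at
  proof
    show "\<forall>\<^sub>F w in at p. w - 1/2 \<in> UNIV \<and> w - 1/2 \<noteq> - of_nat k"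
      unfolding eventually_at_filter by (intro always_eventually) (auto simp: p_def diff_eq_eq)
    have "((\<lambda>w. w - 1/2) \<longlongrightarrow> p - 1/2) (at p)" by (intro tendsto_intros)
    then show "((\<lambda>w. w - 1/2) \<longlongrightarrow> - of_nat k) (at p)" by (simp add: p_def)
  qed
  from filterlim_compose[OF Gamma_residues this]
  have G: "((\<lambda>w. Gamma (w - 1/2) * (w - 1/2 + of_nat k)) \<longlongrightarrow> (-1) ^ k / fact k) (at p)" .
  have "cos (of_real pi * p / 2) \<noteq> 0" using nI by (auto simp: cos_half_pi_eq_0_iff)
  moreover have "1 + s - p \<notin> \<int>\<^sub>\<le>\<^sub>0" using assms by (simp add: p_def algebra_simps)
  moreover have "complex_of_real x \<noteq> 0" using assms by auto
  ultimately have "((\<lambda>w. (Gamma (w - 1/2) * (w - 1/2 + of_nat k)) * Gamma (1 + s - w) * tan (of_real pi * w / 2)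
     * sin (of_real pi * (w - s) / 2) * of_real x powr (- w)) \<longlongrightarrow>
     (-1) ^ k / fact k * Gamma (1 + s - p) * tan (of_real pi * p / 2)
      * sin (of_real pi * (p - s) / 2) * of_real x powr (- p)) (at p)"
    by (intro tendsto_intros G) (use assms in \<open>auto simp: complex_nonpos_Reals_iff\<close>)
  then show ?thesis
    by (simp add: mellin_kernel_def p_def algebra_simps)
qed

text \<open>For odd \<open>k\<close> the sine factor vanishes: these points are removable singularities, included so that the
  residues form a full binomial series.\<close>

lemma kernel_residue_Gamma2:
  assumes "x > 0" "s + 1/2 + of_nat k \<notin> \<int>\<^sub>\<le>\<^sub>0" "s \<notin> \<int>"
  shows "((\<lambda>w. mellin_kernel s x w * (w - (1 + s + of_nat k))) \<longlongrightarrow>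
     - ((-1) ^ k / fact k * Gamma (s + 1/2 + of_nat k) * tan (of_real pi * (1 + s + of_nat k) / 2)
      * sin (of_real pi * (1 + of_nat k) / 2) * of_real x powr (- (1 + s + of_nat k)))) (at (1 + s + of_nat k))"
proof -
  define p :: complex where "p = 1 + s + of_nat k"
  have nI: "p \<notin> \<int>"
  proof
    assume "p \<in> \<int>"
    then have "p - 1 - of_nat k \<in> \<int>" by (intro Ints_diff) auto
    then show False using assms by (simp add: p_def)
  qed
  have "filterlim (\<lambda>w. 1 + s - w) (at (- of_nat k)) (at p)"
    unfolding filterlim_at
  proof
    show "\<forall>\<^sub>F w in at p. 1 + s - w \<in> UNIV \<and> 1 + s - w \<noteq> - of_nat k"
      unfolding eventually_at_filter by (intro always_eventually) (auto simp: p_def algebra_simps)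
    have "((\<lambda>w. 1 + s - w) \<longlongrightarrow> 1 + s - p) (at p)" by (intro tendsto_intros)
    then show "((\<lambda>w. 1 + s - w) \<longlongrightarrow> - of_nat k) (at p)" by (simp add: p_def)
  qed
  from filterlim_compose[OF Gamma_residues this]
  have G: "((\<lambda>w. Gamma (1 + s - w) * (1 + s - w + of_nat k)) \<longlongrightarrow> (-1) ^ k / fact k) (at p)" .
  have "cos (of_real pi * p / 2) \<noteq> 0" using nI by (auto simp: cos_half_pi_eq_0_iff)
  moreover have "p - 1/2 \<notin> \<int>\<^sub>\<le>\<^sub>0" using assms by (simp add: p_def algebra_simps)
  moreover have "complex_of_real x \<noteq> 0" using assms by auto
  \<comment> \<open>The leading minus sign comes from 1 + s - w + k = - (w - (1 + s + k)).\<close>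
  ultimately have "((\<lambda>w. - ((Gamma (1 + s - w) * (1 + s - w + of_nat k)) * Gamma (w - 1/2) * tan (of_real pi * w / 2)
     * sin (of_real pi * (w - s) / 2) * of_real x powr (- w))) \<longlongrightarrow>
     - ((-1) ^ k / fact k * Gamma (p - 1/2) * tan (of_real pi * p / 2)
      * sin (of_real pi * (p - s) / 2) * of_real x powr (- p))) (at p)"
    by (intro tendsto_intros G) (use assms in \<open>auto simp: complex_nonpos_Reals_iff\<close>)
  then show ?thesis
    by (simp add: mellin_kernel_def p_def algebra_simps)
qed

lemma tan_half_pi_residue:
  assumes "odd n"
  shows "((\<lambda>w. tan (of_real pi * w / 2) * (w - of_int n)) \<longlongrightarrow> - (2 / of_real pi)) (at (of_int n :: complex))"
proof -
  define p :: complex where "p = of_int n"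
  have c0: "cos (of_real pi * p / 2) = 0" using assms by (auto simp: cos_half_pi_eq_0_iff p_def)
  then have s0: "sin (of_real pi * p / 2) \<noteq> 0" by (metis sin_zero_norm_cos_one norm_zero zero_neq_one)
  have "((\<lambda>w. cos (of_real pi * w / 2)) has_field_derivative - (of_real pi / 2 * sin (of_real pi * p / 2))) (at p)"
    by (auto intro!: derivative_eq_intros)
  then have "((\<lambda>w. cos (of_real pi * w / 2) / (w - p)) \<longlongrightarrow> - (of_real pi / 2 * sin (of_real pi * p / 2))) (at p)"
    unfolding has_field_derivative_iff by (simp add: c0)
  then have "((\<lambda>w. sin (of_real pi * w / 2) / (cos (of_real pi * w / 2) / (w - p))) \<longlongrightarrow>
      sin (of_real pi * p / 2) / - (of_real pi / 2 * sin (of_real pi * p / 2))) (at p)"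
    using s0 by (intro tendsto_intros) auto
  then show ?thesis
    using s0 by (simp add: tan_def p_def field_simps)
qed

lemma kernel_residue_tan:
  assumes "x > 0" "odd n" "of_int n - 1/2 \<notin> (\<int>\<^sub>\<le>\<^sub>0 :: complex set)" "1 + s - of_int n \<notin> \<int>\<^sub>\<le>\<^sub>0"
  shows "((\<lambda>w. mellin_kernel s x w * (w - of_int n)) \<longlongrightarrow>
     - (2 / of_real pi) * Gamma (of_int n - 1/2) * Gamma (1 + s - of_int n)
      * sin (of_real pi * (of_int n - s) / 2) * of_real x powr (- of_int n)) (at (of_int n))"
proof -
  have "((\<lambda>w. (tan (of_real pi * w / 2) * (w - of_int n)) * Gamma (w - 1/2) * Gamma (1 + s - w)
     * sin (of_real pi * (w - s) / 2) * of_real x powr (- w)) \<longlongrightarrow>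
     - (2 / of_real pi) * Gamma (of_int n - 1/2) * Gamma (1 + s - of_int n)
      * sin (of_real pi * (of_int n - s) / 2) * of_real x powr (- of_int n)) (at (of_int n))"
    using assms by (intro tendsto_intros tan_half_pi_residue) (auto simp: complex_nonpos_Reals_iff)
  then show ?thesis by (simp add: mellin_kernel_def mult_ac)
qed

section \<open>The residues in closed form\<close>

text \<open>At the k-th pole of either Gamma factor the trigonometric part is a multiple of a cosine
  turned by k right angles. Written with powers of i and -i, these turns merge with y^k, and the
  residues sum to binomial series at i y and - i y.\<close>

lemma cos_quarter_turns:
  fixes \<theta> :: complex
  shows "cos (\<theta> - of_nat k * of_real pi / 2) = (exp (- (\<i> * \<theta>)) * \<i> ^ k + exp (\<i> * \<theta>) * (- \<i>) ^ k) / 2"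
proof -
  have "exp (\<i> * of_real pi / 2) = \<i>"
    using cis_conv_exp[of "pi / 2"] by simp
  then have a: "exp (of_nat k * (\<i> * of_real pi / 2)) = \<i> ^ k"
    by (simp only: exp_of_nat_mult)
  have "exp (- (\<i> * of_real pi / 2)) = - \<i>"
    using \<open>exp (\<i> * of_real pi / 2) = \<i>\<close> by (simp add: exp_minus)
  then have b: "exp (of_nat k * (- (\<i> * of_real pi / 2))) = (- \<i>) ^ k"
    by (simp only: exp_of_nat_mult)
  have e1: "\<i> * (\<theta> - of_nat k * of_real pi / 2) = \<i> * \<theta> + of_nat k * (- (\<i> * of_real pi / 2))"
    by (simp add: algebra_simps)
  have e2: "- (\<i> * (\<theta> - of_nat k * of_real pi / 2)) = - (\<i> * \<theta>) + of_nat k * (\<i> * of_real pi / 2)"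
    by (simp add: algebra_simps)
  have "exp (\<i> * (\<theta> - of_nat k * of_real pi / 2)) = exp (\<i> * \<theta>) * (- \<i>) ^ k"
    by (simp only: e1 exp_add b)
  moreover have "exp (- (\<i> * (\<theta> - of_nat k * of_real pi / 2))) = exp (- (\<i> * \<theta>)) * \<i> ^ k"
    by (simp only: e2 exp_add a)
  ultimately show ?thesis
    unfolding cos_exp_eq by (simp only: add.commute)
qed

text \<open>Used with \<theta> = pi/4 + pi s/2 and y = x on the left, and with \<theta> = 0 and y =
  1/x on the right.\<close>

lemma binomial_cos_sums:
  fixes b \<theta> :: complex and y :: real
  assumes "\<bar>y\<bar> < 1"
  shows "(\<lambda>k. ((- b) gchoose k) * of_real y ^ k * cos (\<theta> - of_nat k * of_real pi / 2)) sums
    ((exp (- (\<i> * \<theta>)) * (1 + \<i> * of_real y) powr (- b) + exp (\<i> * \<theta>) * (1 - \<i> * of_real y) powr (- b)) / 2)"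
proof -
  have "(\<lambda>k. ((- b) gchoose k) * (\<i> * of_real y) ^ k) sums (1 + \<i> * of_real y) powr (- b)"
    by (rule gen_binomial_complex) (use assms in \<open>simp add: norm_mult\<close>)
  moreover have "(\<lambda>k. ((- b) gchoose k) * (- \<i> * of_real y) ^ k) sums (1 + (- \<i> * of_real y)) powr (- b)"
    by (rule gen_binomial_complex) (use assms in \<open>simp add: norm_mult\<close>)
  ultimately have "(\<lambda>k. (exp (- (\<i> * \<theta>)) * (((- b) gchoose k) * (\<i> * of_real y) ^ k)
      + exp (\<i> * \<theta>) * (((- b) gchoose k) * (- \<i> * of_real y) ^ k)) / 2) sums
    ((exp (- (\<i> * \<theta>)) * (1 + \<i> * of_real y) powr (- b) + exp (\<i> * \<theta>) * (1 + (- \<i> * of_real y)) powr (- b)) / 2)"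
    by (intro sums_divide sums_add sums_mult)
  then show ?thesis
    unfolding cos_quarter_turns power_mult_distrib by (simp add: algebra_simps)
qed

lemma gbinomial_minus_Gamma:
  fixes b :: complex
  assumes "b \<notin> \<int>\<^sub>\<le>\<^sub>0"
  shows "(-1) ^ k / fact k * Gamma (b + of_nat k) = Gamma b * ((- b) gchoose k)"
  using assms by (simp add: gbinomial_pochhammer pochhammer_Gamma Gamma_eq_zero_iff)

text \<open>The doubled angle has sine sin (k pi) = 0. This separates even from odd k without naming
  the parity.\<close>

lemma sin_or_cos_quarter_turn_eq_0:
  "sin (of_nat k * of_real pi / 2 :: complex) = 0 \<or> cos (of_nat k * of_real pi / 2 :: complex) = 0"
proof -
  have "sin (2 * (of_nat k * of_real pi / 2 :: complex)) = of_real (sin (real k * pi))"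
    by (simp flip: sin_of_real)
  then show ?thesis unfolding sin_double by simp
qed

text \<open>With v = k pi / 2, the tangent of pi/4 - v is 1 if sin v = 0 and -1 if cos v = 0. In
  both cases this sign turns sin (\<alpha> - v) into sin (\<alpha> + v).\<close>

lemma trig_at_Gamma1_poles:
  fixes s :: complex
  shows "tan (of_real pi * (1/2 - of_nat k) / 2) * sin (of_real pi * (1/2 - of_nat k - s) / 2)
    = cos (of_real pi / 4 + of_real pi * s / 2 - of_nat k * of_real pi / 2)"
proof -
  define v :: complex where "v = of_nat k * of_real pi / 2"
  define \<alpha> :: complex where "\<alpha> = of_real pi / 4 - of_real pi * s / 2"
  define q :: complex where "q = of_real (sqrt 2 / 2)"
  have q: "sin (of_real pi / 4) = q" "cos (of_real pi / 4) = q" "q \<noteq> 0"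
    using sin_of_real[where 'a = complex, of "pi/4"] cos_of_real[where 'a = complex, of "pi/4"]
    by (simp_all add: q_def sin_45 cos_45)
  have e1: "of_real pi * (1/2 - of_nat k) / 2 = of_real pi / 4 - v"
    and e2: "of_real pi * (1/2 - of_nat k - s) / 2 = \<alpha> - v"
    by (simp_all add: v_def \<alpha>_def field_simps)
  have e3: "of_real pi / 4 + of_real pi * s / 2 - v = of_real pi / 2 - (\<alpha> + v)"
    by (simp add: \<alpha>_def field_simps)
  have t: "tan (of_real pi / 4 - v) = (cos v - sin v) / (cos v + sin v)"
  proof -
    have "tan (of_real pi / 4 - v) = (q * (cos v - sin v)) / (q * (cos v + sin v))"
      unfolding tan_def sin_diff cos_diff q by (simp add: algebra_simps)
    then show ?thesis using q(3) by simp
  qed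
  have c: "cos (of_real pi / 4 + of_real pi * s / 2 - v) = sin (\<alpha> + v)"
    unfolding e3 by (subst cos_diff) simp
  have "\<not> (sin v = 0 \<and> cos v = 0)" by (metis sin_zero_norm_cos_one norm_zero zero_neq_one)
  then consider "sin v = 0" "cos v \<noteq> 0" | "cos v = 0" "sin v \<noteq> 0"
    using sin_or_cos_quarter_turn_eq_0[of k] unfolding v_def[symmetric] by blast
  then have "tan (of_real pi / 4 - v) * sin (\<alpha> - v) = sin (\<alpha> + v)"
    by cases (simp_all add: t sin_add sin_diff)
  then show ?thesis unfolding e1 e2 using c by (simp only: v_def)
qed

text \<open>With v = k pi / 2, the sine on the left is cos v. It vanishes for odd k, and for even k
  the cotangent at pi s / 2 + v equals the one at pi s / 2.\<close>

lemma trig_at_Gamma2_poles: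
  fixes s :: complex
  shows "tan (of_real pi * (1 + s + of_nat k) / 2) * sin (of_real pi * (1 + of_nat k) / 2)
    = - cot (of_real pi * s / 2) * cos (0 - of_nat k * of_real pi / 2)"
proof -
  define v :: complex where "v = of_nat k * of_real pi / 2"
  define u where "u = of_real pi * s / 2"
  have e1: "of_real pi * (1 + s + of_nat k) / 2 = of_real pi / 2 + (u + v)"
    and e2: "of_real pi * (1 + of_nat k) / 2 = of_real pi / 2 + v"
    by (simp_all add: v_def u_def field_simps)
  have t: "tan (of_real pi / 2 + (u + v)) = - cos (u + v) / sin (u + v)"
    unfolding tan_def by (subst sin_add, subst cos_add) simp
  have sv: "sin (of_real pi / 2 + v) = cos v" by (subst sin_add) simp
  have "\<not> (sin v = 0 \<and> cos v = 0)" by (metis sin_zero_norm_cos_one norm_zero zero_neq_one)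
  then consider "sin v = 0" "cos v \<noteq> 0" | "cos v = 0"
    using sin_or_cos_quarter_turn_eq_0[of k] unfolding v_def[symmetric] by blast
  then have "tan (of_real pi / 2 + (u + v)) * cos v = - cot u * cos v"
    by cases (simp_all add: t sin_add cos_add cot_def)
  then show ?thesis unfolding e1 e2 sv by (simp add: u_def v_def)
qed

text \<open>The parameters pair up by Pochhammer doubling, the powers of 4 cancel, and the parameter
  1 cancels the factorial.\<close>

lemma hypergeometric_small_coeff:
  "fps_nth (fps_hypergeo [s/2, (1 + s) / 2, 1] [1/4, 3/4] 1) n
    = pochhammer s (2 * n) / pochhammer (1/2 :: complex) (2 * n)"
  using pochhammer_double[of "s/2" n] pochhammer_double[of "1/4 :: complex" n]
  by (simp add: pochhammer_fact[symmetric] add_divide_distrib add.commute)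

lemma hypergeometric_large_coeff:
  "fps_nth (fps_hypergeo [1/4, 3/4, 1] [(1 - s) / 2, 1 - s/2] 1) n
    = pochhammer (1/2 :: complex) (2 * n) / pochhammer (1 - s) (2 * n)"
proof -
  have e: "(1 - s) / 2 + 1 / 2 = 1 - s / 2" "2 * ((1 - s) / 2) = 1 - s" by (simp_all add: field_simps)
  show ?thesis
    using pochhammer_double[of "(1 - s)/2" n, unfolded e] pochhammer_double[of "1/4 :: complex" n]
    by (simp add: pochhammer_fact[symmetric])
qed

lemma Gamma_half_plus: "Gamma (1/2 + of_nat n :: complex) = of_real (sqrt pi) * pochhammer (1/2) n"
proof -
  have "(1/2 :: complex) \<notin> \<int>\<^sub>\<le>\<^sub>0" by (rule notin_nonpos_Ints_of_Re) simp
  then show ?thesis using pochhammer_Gamma[of "1/2 :: complex" n]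
    by (simp add: Gamma_one_half_complex)
qed

lemma sin_plus_nat_pi: "sin (z + of_nat n * of_real pi) = (-1) ^ n * sin z" for z :: complex
proof (induction n)
  case (Suc n)
  have "z + of_nat (Suc n) * of_real pi = (z + of_nat n * of_real pi) + of_real pi"
    by (simp add: algebra_simps)
  then show ?case by (simp only: sin_plus_minus_pi Suc.IH power_Suc) simp
qed auto

lemma sin_minus_nat_pi: "sin (z - of_nat n * of_real pi) = (-1) ^ n * sin z" for z :: complex
  using sin_plus_nat_pi[of "z - of_nat n * of_real pi" n]
  by (simp add: uminus_power_if split: if_splits)

text \<open>Reflection at 1/2 + 2 n, where the sine equals 1.\<close>

lemma Gamma_half_minus: "Gamma (1/2 - of_nat (2 * n) :: complex) = of_real (sqrt pi) / pochhammer (1/2) (2 * n)"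
proof -
  have "Gamma (1/2 + of_nat (2 * n) :: complex) * Gamma (1 - (1/2 + of_nat (2 * n))) = of_real pi"
    using sin_plus_nat_pi[of "of_real pi / 2" "2 * n"]
    unfolding Gamma_reflection_complex by (simp add: algebra_simps)
  then have "of_real (sqrt pi) * pochhammer (1/2) (2 * n) * Gamma (1/2 - of_nat (2 * n) :: complex)
      = of_real (sqrt pi) * of_real (sqrt pi)"
    unfolding Gamma_half_plus by (simp flip: of_real_mult)
  then have "pochhammer (1/2) (2 * n) * Gamma (1/2 - of_nat (2 * n) :: complex) = of_real (sqrt pi)"
    by simp
  moreover have "pochhammer (1/2 :: complex) (2 * n) \<noteq> 0"
    using calculation by auto
  ultimately show ?thesis by (simp add: field_simps)
qed

text \<open>The left side is the residue at w = 1 - 2 n. The sign in (- x^2)^n comes from the turn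
  of the sine by n pi.\<close>

lemma tan_residue_small:
  assumes "x > 0" "Re s > 0"
  shows "- (2 / of_real pi) * Gamma (1/2 - of_nat (2 * n)) * Gamma (s + of_nat (2 * n))
      * sin (of_real pi * (1 - of_nat (2 * n) - s) / 2) * complex_of_real x powr (of_nat (2 * n) - 1)
    = - (2 / of_real (sqrt pi)) * cos (of_real pi * s / 2) * Gamma s / of_real x
      * (fps_nth (fps_hypergeo [s/2, (1 + s) / 2, 1] [1/4, 3/4] 1) n * (- ((of_real x)\<^sup>2)) ^ n)"
proof -
  have "s \<notin> \<int>\<^sub>\<le>\<^sub>0" using assms by (intro notin_nonpos_Ints_of_Re)
  then have G: "Gamma (s + of_nat (2 * n)) = Gamma s * pochhammer s (2 * n)"
    by (simp add: pochhammer_Gamma Gamma_eq_zero_iff)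
  have "of_real pi * (1 - of_nat (2 * n) - s) / 2 = (of_real pi / 2 - of_real pi * s / 2) - of_nat n * complex_of_real pi"
    by (simp add: field_simps)
  then have si: "sin (of_real pi * (1 - of_nat (2 * n) - s) / 2) = (-1) ^ n * cos (of_real pi * s / 2)"
    by (simp only: sin_minus_nat_pi) (subst sin_diff, simp)
  have pw: "complex_of_real x powr (of_nat (2 * n) - 1) = of_real x ^ (2 * n) / of_real x"
    using of_real_powr_add_nat[OF assms(1), of "-1" "2 * n"] assms(1)
    by (simp add: powr_minus field_simps)
  have pi: "of_real pi = complex_of_real (sqrt pi) * of_real (sqrt pi)" by (simp flip: of_real_mult)
  have xp: "(- ((complex_of_real x)\<^sup>2)) ^ n = (-1) ^ n * of_real x ^ (2 * n)"
    by (simp add: power_minus[of "_\<^sup>2"] flip: power_mult)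
  have alg: "- (2 / (r * r)) * (r / P) * (g * Q) * (e * c) * (X / y) = - (2 / r) * c * g / y * (Q / P * (e * X))"
    if "r \<noteq> 0" "y \<noteq> 0" for r P g Q e c X y :: complex
    using that by (simp add: field_simps)
  show ?thesis
    unfolding G si pw Gamma_half_minus hypergeometric_small_coeff xp
    by (subst (1) pi, rule alg) (use assms in auto)
qed
text \<open>The left side is the residue at w = 1 + 2 n. Reflection of Gamma(s - 2 n) brings in 1 /
  sin(pi s), which is 1 / (2 S c); its cosine cancels the one from the sine factor and leaves 1 /
  sin(pi s / 2).\<close>

lemma tan_residue_large:
  assumes "x > 0" "s \<notin> \<int>"
  shows "- (2 / of_real pi) * Gamma (of_nat (2 * n) + 1/2) * Gamma (s - of_nat (2 * n))
      * sin (of_real pi * (1 + of_nat (2 * n) - s) / 2) * complex_of_real x powr (- (1 + of_nat (2 * n)))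
    = - (of_real (sqrt pi) * rGamma (1 - s) / (of_real x * sin (of_real pi * s / 2)))
      * (fps_nth (fps_hypergeo [1/4, 3/4, 1] [(1 - s) / 2, 1 - s/2] 1) n * (- (1 / (of_real x)\<^sup>2)) ^ n)"
proof -
  define P where "P = pochhammer (1 - s) (2 * n)"
  define S where "S = sin (of_real pi * s / 2)"
  define c where "c = cos (of_real pi * s / 2)"
  have nI: "1 - s \<notin> \<int>\<^sub>\<le>\<^sub>0"
  proof
    assume "1 - s \<in> \<int>\<^sub>\<le>\<^sub>0"
    then have "1 - s \<in> \<int>" by (rule nonpos_Ints_Int)
    then have "1 - (1 - s) \<in> \<int>" by (intro Ints_diff) auto
    then show False using assms by simp
  qed
  have "sin (of_real pi * s) \<noteq> 0"
  proof
    assume "sin (of_real pi * s) = 0"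
    then obtain k :: int where "of_real pi * s = of_real (k * pi)" using sin_eq_0 by blast
    then have "of_real pi * s = of_real pi * of_int k" by simp
    then have "s = of_int k" by (subst (asm) mult_cancel_left) simp
    then show False using assms by simp
  qed
  moreover have s2: "sin (of_real pi * s) = 2 * S * c"
    using sin_double[of "of_real pi * s / 2"] by (simp add: S_def c_def)
  ultimately have Sc: "S \<noteq> 0" "c \<noteq> 0" by auto
  have G1: "Gamma (1 - s + of_nat (2 * n)) = Gamma (1 - s) * P"
    using pochhammer_Gamma[OF nI, of "2 * n"] nI by (simp add: P_def Gamma_eq_zero_iff)
  have P0: "P \<noteq> 0"
  proof
    assume "P = 0"
    then obtain k where "1 - s = - of_nat k" unfolding P_def pochhammer_eq_0_iff by blast
    then show False using nI minus_of_nat_in_nonpos_Ints by metis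
  qed
  have sn: "sin (of_real pi * (s - of_nat (2 * n))) = sin (of_real pi * s)"
    using sin_minus_nat_pi[of "of_real pi * s" "2 * n"] by (simp add: algebra_simps)
  have "Gamma (s - of_nat (2 * n)) * Gamma (1 - (s - of_nat (2 * n))) = of_real pi / (2 * S * c)"
    unfolding Gamma_reflection_complex sn s2 by simp
  also have "1 - (s - of_nat (2 * n)) = 1 - s + of_nat (2 * n)" by simp
  finally have G2: "Gamma (s - of_nat (2 * n)) = of_real pi * rGamma (1 - s) / (2 * S * c * P)"
    using Sc P0 nI unfolding G1 rGamma_inverse_Gamma by (simp add: Gamma_eq_zero_iff field_simps)
  have "of_real pi * (1 + of_nat (2 * n) - s) / 2 = (of_real pi / 2 - of_real pi * s / 2) + of_nat n * complex_of_real pi"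
    by (simp add: field_simps)
  then have si: "sin (of_real pi * (1 + of_nat (2 * n) - s) / 2) = (-1) ^ n * c"
    by (simp only: sin_plus_nat_pi) (subst sin_diff, simp add: c_def)
  have pw: "complex_of_real x powr (- (1 + of_nat (2 * n))) = of_real (1 / x) ^ (2 * n) / of_real x"
    using of_real_powr_diff_nat[OF assms(1), of "-1" "2 * n"] assms(1)
    by (simp add: powr_minus field_simps)
  have xp: "(- (1 / (complex_of_real x)\<^sup>2)) ^ n = (-1) ^ n * of_real (1 / x) ^ (2 * n)"
    by (simp add: power_minus[of "1 / _\<^sup>2"] power_one_over flip: power_mult)
  have G3: "Gamma (of_nat (2 * n) + 1/2 :: complex) = of_real (sqrt pi) * pochhammer (1/2) (2 * n)"
    using Gamma_half_plus[of "2 * n"] by (simp add: add.commute)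
  have alg: "- (2 / p) * (r * Q) * (p * g / (2 * S * c * P)) * (e * c) * (X / y)
      = - (r * g / (y * S)) * (Q / P * (e * X))"
    if "p \<noteq> 0" for r Q e X y g p :: complex
    using that Sc by (simp add: field_simps)
  show ?thesis
    unfolding G2 G3 si pw xp hypergeometric_large_coeff P_def[symmetric] S_def[symmetric]
    by (rule alg) auto
qed

section \<open>Shifting to the left\<close>

text \<open>A shift by 2 passes two poles of Gamma(w - 1/2) and one pole of the tangent. The indices
  start at 1 because 1/2 and 1 lie to the right of the base line.\<close>

lemma kernel_shift_small:
  assumes "0 < x" "Re s > 0" "- 1/2 < c" "c < 0"
  defines "A \<equiv> \<lambda>k. (-1) ^ k / fact k * Gamma (s + 1/2 + of_nat k) * tan (of_real pi * (1/2 - of_nat k) / 2)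
      * sin (of_real pi * (1/2 - of_nat k - s) / 2) * of_real x powr (of_nat k - 1/2)"
    and "B \<equiv> \<lambda>n. - (2 / of_real pi) * Gamma (1/2 - of_nat (2 * n)) * Gamma (s + of_nat (2 * n))
      * sin (of_real pi * (1 - of_nat (2 * n) - s) / 2) * complex_of_real x powr (of_nat (2 * n) - 1)"
  shows "(LINT t|lborel. mellin_kernel s x (Complex c t)) - (LINT t|lborel. mellin_kernel s x (Complex (c - 2 * real m) t))
    = 2 * of_real pi * ((\<Sum>k\<in>{1..2*m}. A k) + (\<Sum>n\<in>{1..m}. B n))"
proof (cases "m = 0")
  case False
  define P1 where "P1 = (\<lambda>k. 1/2 - of_nat k :: complex) ` {1..2*m}"
  define P2 where "P2 = (\<lambda>n. of_int (1 - 2 * int n) :: complex) ` {1..m}"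
  \<comment> \<open>On its left this open strip ends at the next pole -1/2 - 2 m, and on its right
    at 0, short of the pole 1/2, so it contains no further singularities.\<close>
  define S where "S = {z. - 1/2 - 2 * real m < Re z \<and> Re z < 0}"
  have holo: "mellin_kernel s x holomorphic_on S - (P1 \<union> P2)"
  proof (rule kernel_holomorphic)
    fix z assume z: "z \<in> S - (P1 \<union> P2)"
    show "z - 1/2 \<notin> \<int>\<^sub>\<le>\<^sub>0"
    proof
      assume "z - 1/2 \<in> \<int>\<^sub>\<le>\<^sub>0"
      then obtain k where "z - 1/2 = - of_nat k" by (rule nonpos_Ints_cases')
      then have k: "z = 1/2 - of_nat k" by (simp add: diff_eq_eq)
      then have "k \<in> {1..2*m}" using z by (auto simp: S_def)
      then show False using z k by (auto simp: P1_def)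
    qed
    show "1 + s - z \<notin> \<int>\<^sub>\<le>\<^sub>0" using z assms by (intro notin_nonpos_Ints_of_Re) (auto simp: S_def)
    fix n :: int assume n: "odd n"
    show "z \<noteq> of_int n"
    proof
      assume zn: "z = of_int n"
      obtain k where k: "n = 1 - 2 * k" using n by (elim oddE) (metis add.commute diff_minus_eq_add mult_minus_right)
      have "- 1/2 - 2 * real m < real_of_int n" "real_of_int n < 0" using z zn by (auto simp: S_def)
      then have "1 \<le> k" "k \<le> int m" unfolding k by linarith+
      then have "nat k \<in> {1..m}" "n = 1 - 2 * int (nat k)" using k by auto
      then show False using z zn unfolding P2_def by blast
    qed
  qed (use assms in auto)
  have fin: "finite (P1 \<union> P2)" by (simp add: P1_def P2_def)
  obtain C where C: "\<And>w. c - 2 * real m \<le> Re w \<Longrightarrow> Re w \<le> c \<Longrightarrow> 1 + \<bar>Im s\<bar> \<le> \<bar>Im w\<bar> \<Longrightarrow>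
      norm (mellin_kernel s x w) \<le> C * exp (- \<bar>Im w\<bar>)"
    using kernel_bound_strip[OF assms(1), of "c - 2 * real m" c s] by blast
  have range1: "c - 2 * real m < 1/2 - real k \<and> 1/2 - real k < c" if "k \<in> {1..2*m}" for k
  proof -
    have "1 \<le> real k" "real k \<le> 2 * real m" using that by auto
    then show ?thesis using assms by linarith
  qed
  have range2: "c - 2 * real m < 1 - 2 * real n \<and> 1 - 2 * real n < c" if "n \<in> {1..m}" for n
  proof -
    have "1 \<le> real n" "real n \<le> real m" using that by auto
    then show ?thesis using assms by linarith
  qed
  have Pr: "c - 2 * real m < Re p \<and> Re p < c" if "p \<in> P1 \<union> P2" for p
    using that range1 range2 unfolding P1_def P2_def by fastforce
  have "(LINT t|lborel. mellin_kernel s x (Complex c t)) - (LINT t|lborel. mellin_kernel s x (Complex (c - 2 * real m) t))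
    = 2 * of_real pi * (\<Sum>p\<in>P1 \<union> P2. residue (mellin_kernel s x) p)"
    by (rule vertical_line_shift(3)[of "- 1/2 - 2 * real m" _ _ 0, OF _ _ _ fin Pr holo[unfolded S_def] C])
       (use assms False in auto)
  also have "(\<Sum>p\<in>P1 \<union> P2. residue (mellin_kernel s x) p) = (\<Sum>p\<in>P1. residue (mellin_kernel s x) p) + (\<Sum>p\<in>P2. residue (mellin_kernel s x) p)"
  proof (rule sum.union_disjoint)
    have "p \<notin> \<int>" if "p \<in> P1" for p
    proof -
      from that obtain k where "p = 1/2 - of_nat k" by (auto simp: P1_def)
      then show ?thesis by (intro not_Ints_of_Re[of "- int k"]) auto
    qed
    moreover have "p \<in> \<int>" if "p \<in> P2" for p using that unfolding P2_def by (elim imageE) (simp only: Ints_of_int)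
    ultimately show "P1 \<inter> P2 = {}" by blast
  qed (auto simp: P1_def P2_def)
  also have "(\<Sum>p\<in>P1. residue (mellin_kernel s x) p) = (\<Sum>k\<in>{1..2*m}. residue (mellin_kernel s x) (1/2 - of_nat k))"
    unfolding P1_def by (subst sum.reindex) (auto simp: inj_on_def)
  also have "(\<Sum>p\<in>P2. residue (mellin_kernel s x) p) = (\<Sum>n\<in>{1..m}. residue (mellin_kernel s x) (of_int (1 - 2 * int n)))"
    unfolding P2_def by (subst sum.reindex) (auto simp: inj_on_def)
  also have "(\<Sum>k\<in>{1..2*m}. residue (mellin_kernel s x) (1/2 - of_nat k)) = (\<Sum>k\<in>{1..2*m}. A k)"
  proof (intro sum.cong refl)
    fix k assume k: "k \<in> {1..2*m}"
    then have p: "1/2 - of_nat k \<in> P1 \<union> P2" unfolding P1_def by blast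
    have "s + 1/2 + of_nat k \<notin> \<int>\<^sub>\<le>\<^sub>0" by (rule notin_nonpos_Ints_of_Re) (use assms in auto)
    from kernel_residue_Gamma1[OF assms(1) this]
    show "residue (mellin_kernel s x) (1/2 - of_nat k) = A k"
      unfolding A_def using range1[OF k] assms
      by (intro residue_strip_eqI[OF holo[unfolded S_def] fin p]) auto
  qed
  also have "(\<Sum>n\<in>{1..m}. residue (mellin_kernel s x) (of_int (1 - 2 * int n))) = (\<Sum>n\<in>{1..m}. B n)"
  proof (intro sum.cong refl)
    fix n assume n: "n \<in> {1..m}"
    then have p: "of_int (1 - 2 * int n) \<in> P1 \<union> P2" unfolding P2_def by blast
    define N where "N = 1 - 2 * int n"
    have eq: "of_int N - 1/2 = (1/2 - of_nat (2 * n) :: complex)" "1 + s - of_int N = s + of_nat (2 * n)"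
      "of_int N - s = 1 - of_nat (2 * n) - s" "- of_int N = (of_nat (2 * n) - 1 :: complex)"
      by (simp_all add: N_def)
    have "odd N" by (simp add: N_def)
    moreover have "of_int N - 1/2 \<notin> (\<int>\<^sub>\<le>\<^sub>0 :: complex set)"
      using not_Ints_of_Re[of "N - 1" "of_int N - 1/2"] nonpos_Ints_Int by auto
    moreover have "1 + s - of_int N \<notin> \<int>\<^sub>\<le>\<^sub>0" unfolding eq by (rule notin_nonpos_Ints_of_Re) (use assms in auto)
    ultimately have "((\<lambda>w. mellin_kernel s x w * (w - of_int N)) \<longlongrightarrow> B n) (at (of_int N))"
      using kernel_residue_tan[OF assms(1)] unfolding B_def eq[symmetric] by blast
    then show "residue (mellin_kernel s x) (of_int (1 - 2 * int n)) = B n"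
      unfolding N_def using range2[OF n] assms
      by (intro residue_strip_eqI[OF holo[unfolded S_def] fin p]) auto
  qed
  finally show ?thesis .
qed auto

text \<open>The case \<kappa> = 0 does occur: for odd s the factor cos (pi s / 2) vanishes in the
  formula for x < 1. The hypothesis then says nothing about the unscaled series, but both sides are
  0.\<close>

lemma hypergeometric_sums:
  assumes "(\<lambda>n. \<kappa> * (fps_nth (fps_hypergeo us vs 1) n * z ^ n)) sums L"
  shows "L = \<kappa> * hypergeometric us vs z"
proof (cases "\<kappa> = 0")
  case True
  then show ?thesis using sums_unique2[OF _ sums_zero, of L] assms by simp
next
  case False
  then have "(\<lambda>n. fps_nth (fps_hypergeo us vs 1) n * z ^ n) sums (L / \<kappa>)"
    using sums_divide[OF assms, of \<kappa>] by simp
  then show ?thesis using False by (simp add: hypergeometric_def eval_fps_def sums_iff)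
qed

lemma of_real_powr_half:
  assumes "x > 0"
  shows "complex_of_real x powr (- (1/2)) = 1 / of_real (sqrt x)"
proof -
  have "complex_of_real x powr (of_real (- (1/2))) = of_real (x powr (- (1/2)))"
    using assms by (intro powr_of_real) auto
  then show ?thesis using assms by (simp add: powr_minus powr_half_sqrt inverse_eq_divide)
qed

lemma kernel_integral_small:
  assumes x: "0 < x" "x < 1" and s: "Re s > 0" and c: "- 1/2 < c" "c < 0"
  defines "\<theta> \<equiv> of_real pi / 4 + of_real pi * s / 2" and "b \<equiv> s + 1/2"
  shows "(LINT t|lborel. mellin_kernel s x (Complex c t)) = 2 * of_real pi *
     (Gamma b / of_real (sqrt x) * ((exp (- (\<i> * \<theta>)) * (1 + \<i> * of_real x) powr (- b)
         + exp (\<i> * \<theta>) * (1 - \<i> * of_real x) powr (- b)) / 2 - cos \<theta>)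
      - 2 / of_real (sqrt pi) * cos (of_real pi * s / 2) * Gamma s / of_real x
         * (hypergeometric [s/2, (1 + s) / 2, 1] [1/4, 3/4] (- ((of_real x)\<^sup>2)) - 1))"
proof -
  define J where "J = (\<lambda>c. LINT t|lborel. mellin_kernel s x (Complex c t))"
  define \<kappa> where "\<kappa> = - (2 / of_real (sqrt pi)) * cos (of_real pi * s / 2) * Gamma s / of_real x"
  define A where "A = (\<lambda>k. Gamma b / of_real (sqrt x) * (((- b) gchoose k) * of_real x ^ k * cos (\<theta> - of_nat k * of_real pi / 2)))"
  define B where "B = (\<lambda>n. \<kappa> * (fps_nth (fps_hypergeo [s/2, (1 + s) / 2, 1] [1/4, 3/4] 1) n * (- ((of_real x)\<^sup>2)) ^ n))"
  define SA where "SA = Gamma b / of_real (sqrt x) * ((exp (- (\<i> * \<theta>)) * (1 + \<i> * of_real x) powr (- b)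
         + exp (\<i> * \<theta>) * (1 - \<i> * of_real x) powr (- b)) / 2)"
  have bI: "b \<notin> \<int>\<^sub>\<le>\<^sub>0" unfolding b_def by (rule notin_nonpos_Ints_of_Re) (use s in auto)
  have A_eq: "(-1) ^ k / fact k * Gamma (s + 1/2 + of_nat k) * tan (of_real pi * (1/2 - of_nat k) / 2)
      * sin (of_real pi * (1/2 - of_nat k - s) / 2) * of_real x powr (of_nat k - 1/2) = A k" for k
  proof -
    have pw: "complex_of_real x powr (of_nat k - 1/2) = of_real x ^ k / of_real (sqrt x)"
      using of_real_powr_add_nat[OF x(1), of "- (1/2)" k] of_real_powr_half[OF x(1)]
      by (simp add: add.commute)
    have "(-1) ^ k / fact k * Gamma (s + 1/2 + of_nat k) * tan (of_real pi * (1/2 - of_nat k) / 2)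
      * sin (of_real pi * (1/2 - of_nat k - s) / 2) * of_real x powr (of_nat k - 1/2)
      = ((-1) ^ k / fact k * Gamma (b + of_nat k)) * (tan (of_real pi * (1/2 - of_nat k) / 2)
      * sin (of_real pi * (1/2 - of_nat k - s) / 2)) * of_real x powr (of_nat k - 1/2)"
      by (simp add: b_def mult_ac)
    also have "\<dots> = A k"
      unfolding gbinomial_minus_Gamma[OF bI] trig_at_Gamma1_poles pw A_def \<theta>_def by (simp add: mult_ac)
    finally show ?thesis .
  qed
  have shift: "J c - J (c - 2 * real m) = 2 * of_real pi * ((\<Sum>k\<in>{1..2*m}. A k) + (\<Sum>n\<in>{1..m}. B n))" for m
    unfolding J_def B_def \<kappa>_def
    using kernel_shift_small[OF x(1) s c, of m] by (simp only: A_eq tan_residue_small[OF x(1) s])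
  have A_sums: "A sums SA" unfolding A_def SA_def
    by (intro sums_mult binomial_cos_sums) (use x in auto)
  have A0: "A 0 = Gamma b / of_real (sqrt x) * cos \<theta>" by (simp add: A_def)
  \<comment> \<open>Each shift by 2 takes in two binomial terms, so only partial sums of odd length
    occur.\<close>
  have "filterlim (\<lambda>m. Suc (2 * m)) sequentially sequentially"
    by (rule filterlim_subseq) (simp add: strict_mono_def)
  from filterlim_compose[OF A_sums[unfolded sums_def] this]
  have A_lim: "(\<lambda>m. (\<Sum>k<Suc (2 * m). A k)) \<longlonglongrightarrow> SA" .
  \<comment> \<open>The terms with index 0, whose poles are not crossed, are added to complete both
    series and are corrected for by \<open>A 0\<close> and \<open>B 0\<close>. Solved for the
    tangent residues, the shift identity shows that their series converges.\<close>
  have B_partial: "(\<Sum>n<Suc m. B n) = (J c - J (c - 2 * real m)) / (2 * of_real pi) - ((\<Sum>k<Suc (2 * m). A k) - A 0) + B 0" for m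
  proof -
    have "(\<Sum>k<Suc (2 * m). A k) = A 0 + (\<Sum>k\<in>{1..2*m}. A k)" "(\<Sum>n<Suc m. B n) = B 0 + (\<Sum>n\<in>{1..m}. B n)"
      by (simp_all only: lessThan_Suc_atMost atMost_atLeast0 sum.atLeast_Suc_atMost[OF le0] One_nat_def)
    then show ?thesis using shift[of m] by simp
  qed
  have "(\<lambda>m. \<Sum>n<Suc m. B n) \<longlonglongrightarrow> (J c - 0) / (2 * of_real pi) - (SA - A 0) + B 0"
    unfolding B_partial using left_lines_tendsto_0[OF x s c] A_lim
    by (intro tendsto_intros) (auto simp: J_def)
  then have "B sums (J c / (2 * of_real pi) - (SA - A 0) + B 0)"
    unfolding sums_def by (subst (asm) filterlim_sequentially_Suc) simp
  then have "J c / (2 * of_real pi) - (SA - A 0) + B 0 = \<kappa> * hypergeometric [s/2, (1 + s) / 2, 1] [1/4, 3/4] (- ((of_real x)\<^sup>2))"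
    unfolding B_def by (rule hypergeometric_sums)
  moreover have "B 0 = \<kappa>" by (simp add: B_def)
  ultimately have "J c / (2 * of_real pi) = SA - A 0 + \<kappa> * (hypergeometric [s/2, (1 + s) / 2, 1] [1/4, 3/4] (- ((of_real x)\<^sup>2)) - 1)"
    by (simp add: algebra_simps)
  then have "J c = 2 * of_real pi * (SA - A 0 + \<kappa> * (hypergeometric [s/2, (1 + s) / 2, 1] [1/4, 3/4] (- ((of_real x)\<^sup>2)) - 1))"
    by (simp add: field_simps)
  then show ?thesis
    unfolding J_def SA_def A0 \<kappa>_def by (simp only: right_diff_distrib) (simp add: algebra_simps)
qed

lemma two_powr:
  fixes s :: complex
  shows "2 powr (2 - s) = 4 / 2 powr s" "2 powr (s - 1) = 2 powr s / 2" "2 powr (s + 1) = 2 powr s * 2"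
  using of_real_powr_add_nat[of 2 "- s" 2] of_real_powr_diff_nat[of 2 s 1] of_real_powr_add_nat[of 2 s 1]
  by (simp_all add: powr_minus field_simps)

lemma I_fun_small:
  assumes x: "0 < x" "x < 1" and s: "Re s > 0" and lam: "- 1 < lam" "lam < 0"
  shows "I_fun lam s x = rhs_small s x"
proof -
  define \<theta> :: complex where "\<theta> = of_real pi / 4 + of_real pi * s / 2"
  define b where "b = s + 1/2"
  define X Y where "X = (1 + \<i> * of_real x) powr (- b)" and "Y = (1 - \<i> * of_real x) powr (- b)"
  define H where "H = hypergeometric [s/2, (1 + s) / 2, 1] [1/4, 3/4] (- ((of_real x)\<^sup>2))"
  define C where "C = cos (of_real pi * s / 2)"
  define E where "E = 2 powr s"
  define r q y :: complex where "r = of_real (sqrt pi)" and "q = of_real (sqrt x)" and "y = of_real x"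
  have nz: "E \<noteq> 0" "r \<noteq> 0" "q \<noteq> 0" "y \<noteq> 0" using x by (auto simp: E_def r_def q_def y_def)
  have pi: "of_real pi = r * r" by (simp add: r_def flip: of_real_mult)
  \<comment> \<open>Splitting the exponentials produces the sine and cosine combination in
    \<open>rhs_small\<close>.\<close>
  have ex: "exp (- (\<i> * \<theta>)) = cos \<theta> - \<i> * sin \<theta>" "exp (\<i> * \<theta>) = cos \<theta> + \<i> * sin \<theta>"
    using exp_Euler[of \<theta>] exp_Euler[of "- \<theta>"] by simp_all
  have "I_fun lam s x = of_real (sqrt pi / (8 * pi)) * (2 * of_real pi *
     (Gamma b / q * ((exp (- (\<i> * \<theta>)) * X + exp (\<i> * \<theta>) * Y) / 2 - cos \<theta>)
      - 2 / r * C * Gamma s / y * (H - 1)))"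
    unfolding I_fun_eq_kernel_integral[OF lam x(1)]
    using kernel_integral_small[OF x s, of "lam / 2"] lam
    by (simp add: C_def \<theta>_def b_def X_def Y_def H_def q_def r_def y_def)
  also have "of_real (sqrt pi / (8 * pi)) = r / (8 * of_real pi)"
    by (simp add: r_def)
  also have "r / (8 * of_real pi) * (2 * of_real pi * (Gamma b / q * ((exp (- (\<i> * \<theta>)) * X + exp (\<i> * \<theta>) * Y) / 2 - cos \<theta>)
      - 2 / r * C * Gamma s / y * (H - 1)))
    = - (of_real pi / (4 / E)) * (Gamma s * C / (E / 2 * of_real pi * y) * (H - 1)
       + \<i> * Gamma b / (E * 2 * (r * q)) * (sin \<theta> * (X - Y) + \<i> * cos \<theta> * (X + Y - 2)))"
    unfolding ex pi using nz by (simp add: field_simps)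
  also have "\<dots> = rhs_small s x"
    unfolding rhs_small_def two_powr
    by (simp add: X_def Y_def H_def E_def b_def \<theta>_def q_def r_def y_def C_def real_sqrt_mult)
  finally show ?thesis .
qed

section \<open>Shifting to the right\<close>

text \<open>\<open>d\<close> counts a surplus of odd integers: exactly N + d positive odd integers
  lie to the left of the line Re s + \<delta> + 2 N, whereas 0 < \<delta> < 1 puts exactly 2 N of
  the points 1 + s + k there.\<close>

lemma kernel_shift_large:
  fixes N d :: nat
  assumes x: "0 < x" and s: "Re s > 0" "s \<notin> \<int>" and c: "- 1/2 < c" "c < 0"
    and N: "1 \<le> N" and \<delta>: "0 < \<delta>" "\<delta> < 1"
    and d: "Re s + \<delta> < 2 * real d + 1" "2 * real d - 1 < Re s + \<delta>"
  defines "D \<equiv> \<lambda>n. - (2 / of_real pi) * Gamma (of_nat (2 * n) + 1/2) * Gamma (s - of_nat (2 * n))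
      * sin (of_real pi * (1 + of_nat (2 * n) - s) / 2) * complex_of_real x powr (- (1 + of_nat (2 * n)))"
    and "E \<equiv> \<lambda>k. - ((-1) ^ k / fact k * Gamma (s + 1/2 + of_nat k) * tan (of_real pi * (1 + s + of_nat k) / 2)
      * sin (of_real pi * (1 + of_nat k) / 2) * of_real x powr (- (1 + s + of_nat k)))"
  shows "(LINT t|lborel. mellin_kernel s x (Complex (Re s + \<delta> + 2 * real N) t)) - (LINT t|lborel. mellin_kernel s x (Complex c t))
    = 2 * of_real pi * (Gamma (s + 1/2) * cos (of_real pi / 4 + of_real pi * s / 2) / of_real (sqrt x)
        + (\<Sum>n<N + d. D n) + (\<Sum>k<2 * N. E k))"
proof -
  define L where "L = Re s + \<delta> + 2 * real N"
  \<comment> \<open>The least real part among the singularities that are not crossed.\<close>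
  define b' where "b' = min (Re s + 1 + 2 * real N) (2 * real (N + d) + 1)"
  define P0 where "P0 = {1/2 :: complex}"
  define P1 where "P1 = (\<lambda>n. of_int (1 + 2 * int n) :: complex) ` {..<N + d}"
  define P2 where "P2 = (\<lambda>k. 1 + s + of_nat k) ` {..<2 * N}"
  define P where "P = P0 \<union> (P1 \<union> P2)"
  define S where "S = {z. - 1/2 < Re z \<and> Re z < b'}"
  have Lb': "L < b'" using \<delta> d by (auto simp: L_def b'_def)
  have holo: "mellin_kernel s x holomorphic_on S - P"
  proof (rule kernel_holomorphic)
    fix z assume z: "z \<in> S - P"
    show "z - 1/2 \<notin> \<int>\<^sub>\<le>\<^sub>0"
    proof
      assume "z - 1/2 \<in> \<int>\<^sub>\<le>\<^sub>0"
      then obtain k where "z - 1/2 = - of_nat k" by (rule nonpos_Ints_cases')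
      then have k: "z = 1/2 - of_nat k" by (simp add: diff_eq_eq)
      then have "k = 0" using z by (auto simp: S_def)
      then show False using z k by (auto simp: P_def P0_def)
    qed
    show "1 + s - z \<notin> \<int>\<^sub>\<le>\<^sub>0"
    proof
      assume "1 + s - z \<in> \<int>\<^sub>\<le>\<^sub>0"
      then obtain k where "1 + s - z = - of_nat k" by (rule nonpos_Ints_cases')
      then have k: "z = 1 + s + of_nat k" by (simp add: algebra_simps)
      then have "Re s + 1 + real k < Re s + 1 + 2 * real N" using z by (auto simp: S_def b'_def)
      then have "k \<in> {..<2 * N}" by auto
      then show False using z k unfolding P_def P2_def by blast
    qed
    fix n :: int assume n: "odd n"
    show "z \<noteq> of_int n"
    proof
      assume zn: "z = of_int n"
      obtain k where k: "n = 1 + 2 * k" using n by (elim oddE) (simp add: add.commute)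
      have "- 1/2 < real_of_int n" "real_of_int n < 2 * real (N + d) + 1" using z zn by (auto simp: S_def b'_def)
      then have "real_of_int (- 1) < real_of_int n" "real_of_int n < real_of_int (2 * int (N + d) + 1)" by simp_all
      then have "0 \<le> k" "k < int (N + d)" unfolding k of_int_less_iff by simp_all
      then have "nat k \<in> {..<N + d}" "n = 1 + 2 * int (nat k)" using k by auto
      then show False using z zn unfolding P_def P1_def by blast
    qed
  qed (use assms in auto)
  have fin: "finite P" by (simp add: P_def P0_def P1_def P2_def)
  obtain C where C: "\<And>w. c \<le> Re w \<Longrightarrow> Re w \<le> L \<Longrightarrow> 1 + \<bar>Im s\<bar> \<le> \<bar>Im w\<bar> \<Longrightarrow>
      norm (mellin_kernel s x w) \<le> C * exp (- \<bar>Im w\<bar>)"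
    using kernel_bound_strip[OF x, of c L s] by blast
  have range0: "c < 1/2 \<and> 1/2 < L" using c s \<delta> N unfolding L_def by auto
  have range1: "c < 1 + 2 * real n \<and> 1 + 2 * real n < L" if "n \<in> {..<N + d}" for n
  proof -
    have "real n + 1 \<le> real N + real d" using that by auto
    then show ?thesis using c d unfolding L_def by linarith
  qed
  have range2: "c < 1 + Re s + real k \<and> 1 + Re s + real k < L" if "k \<in> {..<2 * N}" for k
  proof -
    have "real k + 1 \<le> 2 * real N" using that by auto
    then show ?thesis using c s \<delta> unfolding L_def by linarith
  qed
  have Pr: "c < Re p \<and> Re p < L" if "p \<in> P" for p
    using that range0 range1 range2 unfolding P_def P0_def P1_def P2_def by fastforce
  have half: "1/2 \<notin> (\<int> :: complex set)" by (rule not_Ints_of_Re[of 0]) auto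
  have P1I: "p \<in> \<int>" if "p \<in> P1" for p
    using that unfolding P1_def by (elim imageE) (simp only: Ints_of_int)
  have P2I: "p \<notin> \<int>" if pP: "p \<in> P2" for p
  proof
    assume "p \<in> \<int>"
    obtain k where k: "p = 1 + s + of_nat k" using pP by (auto simp: P2_def)
    have "p - (1 + of_nat k) \<in> \<int>" using \<open>p \<in> \<int>\<close> by (intro Ints_diff) auto
    then show False using s k by simp
  qed
  have P2R: "1 < Re p" if "p \<in> P2" for p using that s by (auto simp: P2_def)
  have disj: "P0 \<inter> (P1 \<union> P2) = {}" "P1 \<inter> P2 = {}"
  proof -
    have "1/2 \<notin> P1" using half P1I by blast
    moreover have "1/2 \<notin> P2" using P2R[of "1/2"] by auto
    ultimately show "P0 \<inter> (P1 \<union> P2) = {}" by (auto simp: P0_def)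
    show "P1 \<inter> P2 = {}" using P1I P2I by blast
  qed
  have fins: "finite P0" "finite P1" "finite P2" by (simp_all add: P0_def P1_def P2_def)
  have "(LINT t|lborel. mellin_kernel s x (Complex L t)) - (LINT t|lborel. mellin_kernel s x (Complex c t))
    = 2 * of_real pi * (\<Sum>p\<in>P. residue (mellin_kernel s x) p)"
    by (rule vertical_line_shift(3)[of "- 1/2" _ _ b', OF _ _ _ fin Pr holo[unfolded S_def] C])
       (use c Lb' range0 in auto)
  also have "(\<Sum>p\<in>P. residue (mellin_kernel s x) p) = residue (mellin_kernel s x) (1/2)
      + (\<Sum>p\<in>P1. residue (mellin_kernel s x) p) + (\<Sum>p\<in>P2. residue (mellin_kernel s x) p)"
    unfolding P_def sum.union_disjoint[OF fins(1) finite_UnI[OF fins(2,3)] disj(1)]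
      sum.union_disjoint[OF fins(2,3) disj(2)] by (simp add: P0_def add.assoc)
  also have "(\<Sum>p\<in>P1. residue (mellin_kernel s x) p) = (\<Sum>n<N + d. residue (mellin_kernel s x) (of_int (1 + 2 * int n)))"
    unfolding P1_def by (subst sum.reindex) (auto simp: inj_on_def)
  also have "(\<Sum>p\<in>P2. residue (mellin_kernel s x) p) = (\<Sum>k<2 * N. residue (mellin_kernel s x) (1 + s + of_nat k))"
    unfolding P2_def by (subst sum.reindex) (auto simp: inj_on_def)
  also have "(\<Sum>k<2 * N. residue (mellin_kernel s x) (1 + s + of_nat k)) = (\<Sum>k<2 * N. E k)"
  proof (intro sum.cong refl)
    fix k assume k: "k \<in> {..<2 * N}"
    then have p: "1 + s + of_nat k \<in> P" unfolding P_def P2_def by blast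
    have "s + 1/2 + of_nat k \<notin> \<int>\<^sub>\<le>\<^sub>0" by (rule notin_nonpos_Ints_of_Re) (use s in auto)
    from kernel_residue_Gamma2[OF x this s(2)]
    show "residue (mellin_kernel s x) (1 + s + of_nat k) = E k"
      unfolding E_def using range2[OF k] c Lb'
      by (intro residue_strip_eqI[OF holo[unfolded S_def] fin p]) auto
  qed
  also have "(\<Sum>n<N + d. residue (mellin_kernel s x) (of_int (1 + 2 * int n))) = (\<Sum>n<N + d. D n)"
  proof (intro sum.cong refl)
    fix n assume n: "n \<in> {..<N + d}"
    then have p: "of_int (1 + 2 * int n) \<in> P" unfolding P_def P1_def by blast
    define m where "m = 1 + 2 * int n"
    have eq: "of_int m - 1/2 = (of_nat (2 * n) + 1/2 :: complex)" "1 + s - of_int m = s - of_nat (2 * n)"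
      "of_int m - s = 1 + of_nat (2 * n) - s" "- of_int m = (- (1 + of_nat (2 * n)) :: complex)"
      by (simp_all add: m_def)
    have "odd m" by (simp add: m_def)
    moreover have "of_int m - 1/2 \<notin> (\<int>\<^sub>\<le>\<^sub>0 :: complex set)"
      unfolding eq by (rule notin_nonpos_Ints_of_Re) auto
    moreover have "1 + s - of_int m \<notin> \<int>\<^sub>\<le>\<^sub>0"
    proof
      assume "1 + s - of_int m \<in> \<int>\<^sub>\<le>\<^sub>0"
      then have "1 + s - of_int m \<in> \<int>" by (rule nonpos_Ints_Int)
      then have "(1 + s - of_int m) + of_int (m - 1) \<in> \<int>" by (intro Ints_add) auto
      then show False using s by simp
    qed
    ultimately have "((\<lambda>w. mellin_kernel s x w * (w - of_int m)) \<longlongrightarrow> D n) (at (of_int m))"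
      using kernel_residue_tan[OF x] unfolding D_def eq[symmetric] by blast
    then show "residue (mellin_kernel s x) (of_int (1 + 2 * int n)) = D n"
      unfolding m_def using range1[OF n] c Lb'
      by (intro residue_strip_eqI[OF holo[unfolded S_def] fin p]) auto
  qed
  \<comment> \<open>The pole 1/2 is the member k = 0 of the family 1/2 - k.\<close>
  also have "residue (mellin_kernel s x) (1/2) = Gamma (s + 1/2) * cos (of_real pi / 4 + of_real pi * s / 2) / of_real (sqrt x)"
  proof (rule residue_strip_eqI[OF holo[unfolded S_def] fin])
    have "s + 1/2 + of_nat 0 \<notin> \<int>\<^sub>\<le>\<^sub>0" by (rule notin_nonpos_Ints_of_Re) (use s in auto)
    from kernel_residue_Gamma1[OF x this]
    have "((\<lambda>w. mellin_kernel s x w * (w - 1/2)) \<longlongrightarrow>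
      Gamma (s + 1/2) * (tan (of_real pi * (1/2 - of_nat 0) / 2) * sin (of_real pi * (1/2 - of_nat 0 - s) / 2))
       * of_real x powr (- (1/2))) (at (1/2))"
      by (simp add: mult.assoc)
    then show "((\<lambda>w. mellin_kernel s x w * (w - 1/2)) \<longlongrightarrow>
        Gamma (s + 1/2) * cos (of_real pi / 4 + of_real pi * s / 2) / of_real (sqrt x)) (at (1/2))"
      unfolding trig_at_Gamma1_poles of_real_powr_half[OF x] by simp
  qed (use range0 Lb' in \<open>auto simp: P_def P0_def\<close>)
  finally show ?thesis unfolding L_def .
qed

lemma kernel_integral_large:
  assumes x: "1 < x" and s: "Re s > 0" "s \<notin> \<int>" and c: "- 1/2 < c" "c < 0"
  defines "b \<equiv> s + 1/2"
  shows "(LINT t|lborel. mellin_kernel s x (Complex c t)) = - (2 * of_real pi *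
     (Gamma b * cos (of_real pi / 4 + of_real pi * s / 2) / of_real (sqrt x)
      + cot (of_real pi * s / 2) * Gamma b * of_real x powr (- s - 1)
        * (((1 + \<i> / of_real x) powr (- b) + (1 - \<i> / of_real x) powr (- b)) / 2)
      - of_real (sqrt pi) * rGamma (1 - s) / (of_real x * sin (of_real pi * s / 2))
         * hypergeometric [1/4, 3/4, 1] [(1 - s) / 2, 1 - s/2] (- (1 / (of_real x)\<^sup>2))))"
proof -
  have x0: "0 < x" using x by simp
  define J where "J = (\<lambda>c. LINT t|lborel. mellin_kernel s x (Complex c t))"
  define \<kappa> where "\<kappa> = - (of_real (sqrt pi) * rGamma (1 - s) / (of_real x * sin (of_real pi * s / 2)))"
  define R0 where "R0 = Gamma b * cos (of_real pi / 4 + of_real pi * s / 2) / of_real (sqrt x)"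
  define q where "q = cot (of_real pi * s / 2) * Gamma b * of_real x powr (- s - 1)"
  define E where "E = (\<lambda>k. q * (((- b) gchoose k) * of_real (1 / x) ^ k * cos (0 - of_nat k * of_real pi / 2)))"
  define D where "D = (\<lambda>n. \<kappa> * (fps_nth (fps_hypergeo [1/4, 3/4, 1] [(1 - s) / 2, 1 - s/2] 1) n * (- (1 / (of_real x)\<^sup>2)) ^ n))"
  define SE where "SE = q * ((exp (- (\<i> * 0)) * (1 + \<i> * of_real (1 / x)) powr (- b)
         + exp (\<i> * 0) * (1 - \<i> * of_real (1 / x)) powr (- b)) / 2)"
  have bI: "b \<notin> \<int>\<^sub>\<le>\<^sub>0" unfolding b_def by (rule notin_nonpos_Ints_of_Re) (use s in auto)
  have E_eq: "- ((-1) ^ k / fact k * Gamma (s + 1/2 + of_nat k) * tan (of_real pi * (1 + s + of_nat k) / 2)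
      * sin (of_real pi * (1 + of_nat k) / 2) * of_real x powr (- (1 + s + of_nat k))) = E k" for k
  proof -
    have pw: "complex_of_real x powr (- (1 + s + of_nat k)) = of_real x powr (- s - 1) * of_real (1 / x) ^ k"
    proof -
      have "- (1 + s + of_nat k) = - s - 1 - of_nat k" by simp
      then show ?thesis by (simp only: of_real_powr_diff_nat[OF x0])
    qed
    have "- ((-1) ^ k / fact k * Gamma (s + 1/2 + of_nat k) * tan (of_real pi * (1 + s + of_nat k) / 2)
      * sin (of_real pi * (1 + of_nat k) / 2) * of_real x powr (- (1 + s + of_nat k)))
      = - (((-1) ^ k / fact k * Gamma (b + of_nat k)) * (tan (of_real pi * (1 + s + of_nat k) / 2)
      * sin (of_real pi * (1 + of_nat k) / 2)) * of_real x powr (- (1 + s + of_nat k)))"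
      by (simp only: b_def mult.assoc)
    also have "\<dots> = E k"
      unfolding gbinomial_minus_Gamma[OF bI] trig_at_Gamma2_poles pw E_def q_def by (simp only: mult_ac mult_minus_left mult_minus_right minus_minus)
    finally show ?thesis .
  qed
  \<comment> \<open>an offset for which the shifted lines avoid the odd integers and \<open>1 + s + \<nat>\<close>\<close>
  obtain \<delta> where \<delta>: "0 < \<delta>" "\<delta> < 1" "\<And>n. odd n \<Longrightarrow> Re s + \<delta> \<noteq> of_int n"
  proof (cases "\<exists>n. odd n \<and> Re s + 1/2 = of_int n")
    case False
    then show ?thesis using that[of "1/2"] by auto
  next
    case True
    then obtain n where n: "Re s + 1/2 = of_int n" by blast
    \<comment> \<open>The offsets 1/2 and 1/3 differ by 1/6, so they cannot both lead to an
      integer.\<close>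
    have "Re s + 1/3 \<noteq> of_int m" for m
    proof
      assume "Re s + 1/3 = of_int m"
      then have "real_of_int n - real_of_int m = 1/6" using n by linarith
      then have "real_of_int (6 * (n - m)) = real_of_int 1" by simp
      then have "6 * (n - m) = 1" by (simp only: of_int_eq_iff)
      then show False by presburger
    qed
    then show ?thesis using that[of "1/3"] by auto
  qed
  \<comment> \<open>The number of odd integers 1, 3, 5, ... below Re s + \<delta>.\<close>
  define d where "d = nat \<lceil>(Re s + \<delta> - 1) / 2\<rceil>"
  have d: "Re s + \<delta> < 2 * real d + 1" "2 * real d - 1 < Re s + \<delta>"
  proof -
    have "- 1 < (Re s + \<delta> - 1) / 2" using s \<delta> by simp
    then have "0 \<le> \<lceil>(Re s + \<delta> - 1) / 2\<rceil>" by linarith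
    then have "real d = of_int \<lceil>(Re s + \<delta> - 1) / 2\<rceil>" by (simp add: d_def)
    then have "(Re s + \<delta> - 1) / 2 \<le> real d" "real d - 1 < (Re s + \<delta> - 1) / 2"
      using ceiling_correct[of "(Re s + \<delta> - 1) / 2"] by simp_all
    moreover have "Re s + \<delta> \<noteq> of_int (2 * int d + 1)" by (intro \<delta>(3)) simp
    then have "Re s + \<delta> \<noteq> 2 * real d + 1" by simp
    ultimately show "Re s + \<delta> < 2 * real d + 1" "2 * real d - 1 < Re s + \<delta>" by (simp_all add: less_le field_simps)
  qed
  have shift: "J (Re s + \<delta> + 2 * real (Suc n)) - J c
      = 2 * of_real pi * (R0 + (\<Sum>j<Suc n + d. D j) + (\<Sum>k<2 * Suc n. E k))" for n
    unfolding J_def D_def \<kappa>_def R0_def b_def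
    using kernel_shift_large[OF x0 s c _ \<delta>(1,2) d, of "Suc n"] by (simp only: E_eq tan_residue_large[OF x0 s(2)])
  have E_sums: "E sums SE" unfolding E_def SE_def
    by (intro sums_mult binomial_cos_sums) (use x in auto)
  have "filterlim (\<lambda>n. 2 * Suc n) sequentially sequentially"
    by (rule filterlim_subseq) (simp add: strict_mono_def)
  from filterlim_compose[OF E_sums[unfolded sums_def] this]
  have E_lim: "(\<lambda>n. (\<Sum>k<2 * Suc n. E k)) \<longlonglongrightarrow> SE" .
  have D_partial: "(\<Sum>j<n + Suc d. D j) = (J (Re s + \<delta> + 2 * (real n + 1)) - J c) / (2 * of_real pi) - R0 - (\<Sum>k<2 * Suc n. E k)" for n
    using shift[of n] by (simp add: field_simps)
  have "(\<lambda>n. \<Sum>j<n + Suc d. D j) \<longlonglongrightarrow> (0 - J c) / (2 * of_real pi) - R0 - SE"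
    unfolding D_partial using right_lines_tendsto_0[OF x s(1) \<delta>]
    by (intro tendsto_intros E_lim) (auto simp: J_def)
  \<comment> \<open>A fixed offset of the index does not affect the limit, so the surplus
    \<open>d\<close> of tangent residues disappears here.\<close>
  then have "(\<lambda>n. \<Sum>j<n. D j) \<longlonglongrightarrow> (0 - J c) / (2 * of_real pi) - R0 - SE" by (rule LIMSEQ_offset)
  then have "D sums ((0 - J c) / (2 * of_real pi) - R0 - SE)" by (simp only: sums_def)
  then have "(0 - J c) / (2 * of_real pi) - R0 - SE = \<kappa> * hypergeometric [1/4, 3/4, 1] [(1 - s) / 2, 1 - s/2] (- (1 / (of_real x)\<^sup>2))"
    unfolding D_def by (rule hypergeometric_sums)
  then have "(0 - J c) / (2 * of_real pi) = \<kappa> * hypergeometric [1/4, 3/4, 1] [(1 - s) / 2, 1 - s/2] (- (1 / (of_real x)\<^sup>2)) + SE + R0"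
    by (simp only: diff_eq_eq)
  then have "0 - J c = (\<kappa> * hypergeometric [1/4, 3/4, 1] [(1 - s) / 2, 1 - s/2] (- (1 / (of_real x)\<^sup>2)) + SE + R0) * (2 * of_real pi)"
    by (simp only: divide_eq_eq) (simp add: mult.commute)
  then have "J c = - (2 * of_real pi * (R0 + SE + \<kappa> * hypergeometric [1/4, 3/4, 1] [(1 - s) / 2, 1 - s/2] (- (1 / (of_real x)\<^sup>2))))"
    by (simp add: minus_equation_iff[of "J c"] algebra_simps)
  moreover have "SE = q * (((1 + \<i> / of_real x) powr (- b) + (1 - \<i> / of_real x) powr (- b)) / 2)"
    by (simp add: SE_def)
  ultimately show ?thesis
    unfolding J_def R0_def \<kappa>_def q_def by simp
qed

text \<open>Reflection turns 1 / Gamma(1/4 - s/2) into Gamma(3/4 + s/2) times a sine, and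
  duplication joins this with Gamma(1/4 + s/2). It identifies the residue at w = 1/2 with the first
  term of \<open>rhs_large\<close>.\<close>

lemma Gamma_quarter_ratio:
  assumes "Re s > 0"
  shows "Gamma (1/4 + s/2) * rGamma (1/4 - s/2)
    = of_real (sqrt 2) / (2 powr s * of_real (sqrt pi)) * Gamma (s + 1/2) * cos (of_real pi / 4 + of_real pi * s / 2)"
proof -
  have nI: "1/4 + s/2 \<notin> \<int>\<^sub>\<le>\<^sub>0" "1/4 + s/2 + 1/2 \<notin> \<int>\<^sub>\<le>\<^sub>0"
    by (rule notin_nonpos_Ints_of_Re, use assms in simp)+
  have e: "1 - (1/4 - s/2) = 1/4 + s/2 + 1/2" "2 * (1/4 + s/2) = s + 1/2" "1 - 2 * (1/4 + s/2) = 1/2 - s"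
    by (simp_all add: field_simps)
  have "sin (of_real pi * (1/4 - s/2)) = cos (of_real pi / 4 + of_real pi * s / 2)"
  proof -
    have "of_real pi * (1/4 - s/2) = of_real pi / 2 - (of_real pi / 4 + of_real pi * s / 2)" by (simp add: field_simps)
    then show ?thesis by (simp only: sin_diff) simp
  qed
  then have "rGamma (1/4 - s/2) * rGamma (1/4 + s/2 + 1/2) = cos (of_real pi / 4 + of_real pi * s / 2) / of_real pi"
    using rGamma_reflection_complex[of "1/4 - s/2", unfolded e] by simp
  moreover have g0: "Gamma (1/4 + s/2 + 1/2) \<noteq> 0" using nI(2) by (simp only: Gamma_eq_zero_iff) simp
  moreover have "u = g * v" if "u * inverse g = v" "g \<noteq> 0" for u g v :: complex
    using that by (auto simp: field_simps)
  ultimately have r: "rGamma (1/4 - s/2) = Gamma (1/4 + s/2 + 1/2) * (cos (of_real pi / 4 + of_real pi * s / 2) / of_real pi)"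
    by (simp only: rGamma_inverse_Gamma[of "1/4 + s/2 + 1/2"])
  have "exp ((1/2 - s) * of_real (ln 2)) = of_real (sqrt 2) / 2 powr s"
  proof -
    have "sqrt 2 = exp (ln 2 / 2)" using powr_half_sqrt[of 2] by (simp add: powr_def)
    then have "complex_of_real (sqrt 2) = exp (of_real (ln 2) / 2)" by (simp add: exp_of_real[symmetric])
    then show ?thesis by (simp add: powr_def exp_diff left_diff_distrib Ln_of_real[of 2, simplified])
  qed
  then have leg: "Gamma (1/4 + s/2) * Gamma (1/4 + s/2 + 1/2) = of_real (sqrt 2) / 2 powr s * of_real (sqrt pi) * Gamma (s + 1/2)"
    using Gamma_legendre_duplication[OF nI, unfolded e] by simp
  have pi: "of_real pi = of_real (sqrt pi) * complex_of_real (sqrt pi)" by (simp flip: of_real_mult)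
  have "Gamma (1/4 + s/2) * rGamma (1/4 - s/2)
      = (Gamma (1/4 + s/2) * Gamma (1/4 + s/2 + 1/2)) * (cos (of_real pi / 4 + of_real pi * s / 2) / of_real pi)"
    unfolding r by (simp only: mult.assoc)
  also have "\<dots> = of_real (sqrt 2) / 2 powr s * of_real (sqrt pi) * Gamma (s + 1/2)
      * (cos (of_real pi / 4 + of_real pi * s / 2) / (of_real (sqrt pi) * of_real (sqrt pi)))"
    unfolding leg pi[symmetric] ..
  finally show ?thesis by (simp add: field_simps)
qed

lemma I_fun_large:
  assumes x: "1 < x" and s: "Re s > 0" "s \<notin> \<int>" and lam: "- 1 < lam" "lam < 0"
  shows "I_fun lam s x = rhs_large 1 s x"
proof -
  have x0: "0 < x" using x by simp
  define b where "b = s + 1/2"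
  define X Y where "X = (1 + \<i> / of_real x) powr (- b)" and "Y = (1 - \<i> / of_real x) powr (- b)"
  define H where "H = hypergeometric [1/4, 3/4, 1] [(1 - s) / 2, 1 - s/2] (- (1 / (of_real x)\<^sup>2))"
  define C where "C = cos (of_real pi / 4 + of_real pi * s / 2)"
  define S where "S = sin (of_real pi * s / 2)"
  define T where "T = cot (of_real pi * s / 2)"
  define W where "W = complex_of_real x powr (- s - 1)"
  define E where "E = 2 powr s"
  define r q y z :: complex where "r = of_real (sqrt pi)" and "q = of_real (sqrt x)" and "y = of_real x"
    and "z = of_real (sqrt 2)"
  have nz: "E \<noteq> 0" "r \<noteq> 0" "q \<noteq> 0" "y \<noteq> 0" "z \<noteq> 0"
    using x0 by (auto simp: E_def r_def q_def y_def z_def)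
  have pi: "of_real pi = r * r" by (simp add: r_def flip: of_real_mult)
  have S0: "S \<noteq> 0"
  proof
    assume "S = 0"
    then obtain n :: int where "of_real pi * s / 2 = of_real (n * pi)" unfolding S_def using sin_eq_0 by blast
    then have "of_real pi * s = of_real pi * of_int (2 * n)" by (simp add: field_simps)
    then have "s = of_int (2 * n)" by (subst (asm) mult_cancel_left) simp
    then show False using s by simp
  qed
  have "I_fun lam s x = of_real (sqrt pi / (8 * pi)) * - (2 * of_real pi *
     (Gamma b * C / q + T * Gamma b * W * ((X + Y) / 2) - r * rGamma (1 - s) / (y * S) * H))"
    unfolding I_fun_eq_kernel_integral[OF lam x0]
    using kernel_integral_large[OF x s, of "lam / 2"] lam
    by (simp add: C_def b_def X_def Y_def H_def q_def r_def y_def S_def T_def W_def)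
  also have "of_real (sqrt pi / (8 * pi)) = r / (8 * of_real pi)" by (simp add: r_def)
  also have "r / (8 * of_real pi) * - (2 * of_real pi *
     (Gamma b * C / q + T * Gamma b * W * ((X + Y) / 2) - r * rGamma (1 - s) / (y * S) * H))
    = - (of_real pi / (4 / E)) * (z / (E * r) * Gamma b * C / (z * q)
       + 1 * W * T / (E * 2 * r) * Gamma b * (X + Y) - 1 / (y * E * S) * rGamma (1 - s) * H)"
    unfolding pi using nz S0 by (simp add: field_simps)
  also have "z / (E * r) * Gamma b * C = Gamma (1/4 + s/2) * rGamma (1/4 - s/2)"
    using Gamma_quarter_ratio[OF s(1)] by (simp add: z_def E_def r_def b_def C_def)
  also have "- (of_real pi / (4 / E)) * (Gamma (1/4 + s/2) * rGamma (1/4 - s/2) / (z * q)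
       + 1 * W * T / (E * 2 * r) * Gamma b * (X + Y) - 1 / (y * E * S) * rGamma (1 - s) * H) = rhs_large 1 s x"
    unfolding rhs_large_def two_powr
    by (simp add: X_def Y_def H_def E_def b_def q_def r_def y_def z_def S_def T_def W_def real_sqrt_mult)
  finally show ?thesis .
qed

section \<open>Boundary values and the limit at integers\<close>

text \<open>By the limit formulas for Gamma(1/2) and 1 / Gamma(s), the quotient divided by n^(s -
  1/2) converges, hence is bounded. \<open>Suc n\<close> is the length of the products in these
  formulas.\<close>

lemma pochhammer_quotient_bound:
  fixes s :: complex
  shows "\<exists>K. \<forall>n\<ge>1. norm (pochhammer s (Suc n) / pochhammer (1/2) (Suc n)) \<le> K * real n powr (Re s - 1/2)"
proof -
  have "(\<lambda>n. Gamma_series (1/2) n * rGamma_series s n) \<longlonglongrightarrow> Gamma (1/2 :: complex) * rGamma s"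
    by (intro tendsto_mult Gamma_series_LIMSEQ rGamma_series_LIMSEQ)
  then have "Bseq (\<lambda>n. Gamma_series (1/2) n * rGamma_series s n)"
    by (intro convergent_imp_Bseq) (auto simp: convergent_def)
  then obtain K where K: "\<And>n. norm (Gamma_series (1/2) n * rGamma_series s n) \<le> K"
    by (auto simp: Bseq_def)
  have "norm (pochhammer s (Suc n) / pochhammer (1/2) (Suc n)) \<le> K * real n powr (Re s - 1/2)" if "n \<ge> 1" for n
  proof -
    have "pochhammer s (Suc n) / pochhammer (1/2) (Suc n)
      = (Gamma_series (1/2) n * rGamma_series s n) * exp ((s - 1/2) * of_real (ln (of_nat n)))"
      by (simp add: Gamma_series_def rGamma_series_def left_diff_distrib exp_diff)
    also have "norm \<dots> = norm (Gamma_series (1/2) n * rGamma_series s n) * real n powr (Re s - 1/2)"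
      using that by (simp add: norm_mult powr_def)
    also have "\<dots> \<le> K * real n powr (Re s - 1/2)"
      by (intro mult_right_mono K) auto
    finally show ?thesis .
  qed
  then show ?thesis by blast
qed

text \<open>A substitute for Abel's limit theorem: multiplying by \<open>1 + y\<close> makes the series converge normally on \<open>[0, 1]\<close>.\<close>

lemma alternating_series_continuous:
  fixes u :: "nat \<Rightarrow> complex"
  assumes "u \<longlonglongrightarrow> 0" and diff: "summable (\<lambda>n. norm (u (Suc n) - u n))"
  shows "continuous_on {0..1} (\<lambda>y::real. \<Sum>n. u n * (- of_real y) ^ n)"
proof -
  \<comment> \<open>\<open>g n y\<close> is the term of degree n + 1 in the product of the series
    with 1 + y.\<close>
  define g where "g = (\<lambda>n (y::real). (u (Suc n) - u n) * (- complex_of_real y) ^ Suc n)"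
  have bound: "norm (g n y) \<le> norm (u (Suc n) - u n)" if "y \<in> {0..1}" for n y
  proof -
    have "\<bar>y\<bar> ^ Suc n \<le> 1" using that by (intro power_le_one) auto
    then show ?thesis
      unfolding g_def norm_mult norm_power norm_minus_cancel norm_of_real
      by (intro mult_left_le) auto
  qed
  have "uniform_limit {0..1} (\<lambda>n y. \<Sum>i<n. g i y) (\<lambda>y. \<Sum>i. g i y) sequentially"
    by (rule Weierstrass_m_test[OF bound diff])
  then have cont: "continuous_on {0..1} (\<lambda>y. \<Sum>i. g i y)"
    by (rule uniform_limit_theorem[rotated])
      (auto simp: g_def intro!: always_eventually continuous_intros)
  have eq: "(\<Sum>n. u n * (- of_real y) ^ n) = (u 0 + (\<Sum>i. g i y)) / (1 + of_real y)" if y: "y \<in> {0..1}" for y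
  proof -
    have nz: "1 + complex_of_real y \<noteq> 0" using y by (simp add: complex_eq_iff)
    \<comment> \<open>For finite sums the product with 1 + y leaves a boundary term, which vanishes
      in the limit because u tends to 0.\<close>
    have partial: "(\<Sum>n<N. u n * (- of_real y) ^ n) = (u 0 + (\<Sum>i<N. g i y) - u N * (- of_real y) ^ N) / (1 + of_real y)" for N
    proof -
      have "(1 + of_real y) * (\<Sum>n<N. u n * (- of_real y) ^ n) = u 0 + (\<Sum>i<N. g i y) - u N * (- of_real y) ^ N"
        by (induction N) (simp_all add: g_def algebra_simps)
      then show ?thesis using nz by (simp add: eq_divide_eq mult.commute)
    qed
    have "summable (\<lambda>i. g i y)"
      by (rule summable_comparison_test[OF _ diff]) (use bound[OF y] in auto)
    then have g: "(\<lambda>N. \<Sum>i<N. g i y) \<longlonglongrightarrow> (\<Sum>i. g i y)" by (rule summable_LIMSEQ)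
    have "(\<lambda>N. u N * (- of_real y) ^ N) \<longlonglongrightarrow> 0"
    proof (rule Lim_null_comparison)
      have "\<bar>y\<bar> ^ N \<le> 1" for N using y by (intro power_le_one) auto
      then show "\<forall>\<^sub>F N in sequentially. norm (u N * (- of_real y) ^ N) \<le> norm (u N)"
        by (intro always_eventually) (auto simp: norm_mult norm_power intro!: mult_left_le)
      show "(\<lambda>N. norm (u N)) \<longlonglongrightarrow> 0" using assms(1) by (rule tendsto_norm_zero)
    qed
    then have "(\<lambda>N. \<Sum>n<N. u n * (- of_real y) ^ n) \<longlonglongrightarrow> (u 0 + (\<Sum>i. g i y) - 0) / (1 + of_real y)"
      unfolding partial using nz by (intro tendsto_intros g)
    then show ?thesis by (simp add: sums_def sums_unique[symmetric] flip: sums_def)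
  qed
  have "continuous_on {0..1} (\<lambda>y. (u 0 + (\<Sum>i. g i y)) / (1 + of_real y))"
    by (intro continuous_intros cont) (auto simp: complex_eq_iff)
  then show ?thesis by (subst continuous_on_cong[OF refl eq])
qed

text \<open>u n is at most of size n^(Re s - 1/2). In u (n + 1) / u n - 1 the quadratic terms
  cancel, which gains a factor 1/n, so the differences are at most of size n^(Re s - 3/2) and
  summable for Re s < 1/2.\<close>

lemma small_coeff_variation:
  fixes s :: complex
  assumes s: "Re s > 0" "Re s < 1/2"
  defines "u \<equiv> \<lambda>n. pochhammer s (2 * n) / pochhammer (1/2) (2 * n)"
  shows "u \<longlonglongrightarrow> 0" "summable (\<lambda>n. norm (u (Suc n) - u n))"
proof -
  obtain K where K: "\<And>n. n \<ge> 1 \<Longrightarrow> norm (pochhammer s (Suc n) / pochhammer (1/2) (Suc n)) \<le> K * real n powr (Re s - 1/2)"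
    using pochhammer_quotient_bound by blast
  have K0: "0 \<le> K" using order_trans[OF norm_ge_zero K[of 1]] by simp
  have ub: "norm (u n) \<le> K * real n powr (Re s - 1/2)" if "n \<ge> 1" for n
  proof -
    \<comment> \<open>The general bound concerns Pochhammer symbols of index \<open>Suc m\<close>,
      here 2 n. The exponent is negative and n <= m, so m may be replaced by n.\<close>
    define m where "m = 2 * n - 1"
    have m: "2 * n = Suc m" "1 \<le> m" "n \<le> m" using that by (auto simp: m_def)
    have "norm (u n) \<le> K * real m powr (Re s - 1/2)"
      unfolding u_def m(1) by (rule K[OF m(2)])
    also have "\<dots> \<le> K * real n powr (Re s - 1/2)"
      using that m s K0 by (intro mult_left_mono powr_mono2') auto
    finally show ?thesis .
  qed
  have "(\<lambda>n. K * real n powr (Re s - 1/2)) \<longlonglongrightarrow> K * 0"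
    using s by (intro tendsto_mult tendsto_const tendsto_neg_powr filterlim_real_sequentially) auto
  then have "(\<lambda>n. K * real n powr (Re s - 1/2)) \<longlonglongrightarrow> 0" by simp
  moreover have "\<forall>\<^sub>F n in sequentially. norm (u n) \<le> K * real n powr (Re s - 1/2)"
    using ub by (rule eventually_sequentiallyI)
  ultimately show "u \<longlonglongrightarrow> 0" by (rule Lim_null_comparison[rotated])
  define M where "M = norm (s * (s + 1) - 3/4) + norm (2 * s - 1)"
  have db: "norm (u (Suc n) - u n) \<le> K * M * real n powr (Re s - 3/2)" if n: "n \<ge> 1" for n
  proof -
    define v where "v = 2 * (of_nat n :: complex)"
    define e where "e = (1/2 + v) * (3/2 + v)"
    have e: "norm e = (1/2 + 2 * real n) * (3/2 + 2 * real n)"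
    proof -
      have "e = of_real ((1/2 + 2 * real n) * (3/2 + 2 * real n))" by (simp add: e_def v_def)
      then show ?thesis by (simp only: norm_of_real) (simp add: abs_mult)
    qed
    have "norm e > 0" unfolding e by (intro mult_pos_pos) auto
    then have e0: "e \<noteq> 0" by auto
    have p: "pochhammer (1/2 :: complex) (2 * n) \<noteq> 0"
    proof
      assume "pochhammer (1/2 :: complex) (2 * n) = 0"
      then obtain k where "(1/2 :: complex) = - of_nat k" unfolding pochhammer_eq_0_iff by blast
      from arg_cong[OF this, of Re] show False by simp
    qed
    have "pochhammer s (2 * Suc n) = pochhammer s (2 * n) * ((s + v) * (s + 1 + v))"
      "pochhammer (1/2) (2 * Suc n) = pochhammer (1/2) (2 * n) * e"
      by (simp_all add: pochhammer_rec' v_def e_def algebra_simps)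
    then have "u (Suc n) - u n = u n * (((s + v) * (s + 1 + v) - e) / e)"
      unfolding u_def using e0 p by (simp add: field_simps)
    also have "(s + v) * (s + 1 + v) - e = (s * (s + 1) - 3/4) + (2 * s - 1) * v"
      by (simp add: e_def algebra_simps)
    finally have "norm (u (Suc n) - u n) = norm (u n) * (norm ((s * (s + 1) - 3/4) + (2 * s - 1) * v) / norm e)"
      by (simp add: norm_mult norm_divide)
    also have "norm ((s * (s + 1) - 3/4) + (2 * s - 1) * v) / norm e \<le> M / real n"
    proof -
      have nv: "norm v = 2 * real n" by (simp add: v_def norm_mult)
      have "norm ((s * (s + 1) - 3/4) + (2 * s - 1) * v) \<le> norm (s * (s + 1) - 3/4) * 1 + norm (2 * s - 1) * (2 * real n)"
        using norm_triangle_ineq[of "s * (s + 1) - 3/4" "(2 * s - 1) * v"] by (simp add: norm_mult nv)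
      also have "\<dots> \<le> norm (s * (s + 1) - 3/4) * (2 * real n) + norm (2 * s - 1) * (2 * real n)"
        using n by (intro add_mono mult_left_mono) auto
      also have "\<dots> = M * (2 * real n)" by (simp add: M_def algebra_simps)
      finally have "norm ((s * (s + 1) - 3/4) + (2 * s - 1) * v) / norm e \<le> M * (2 * real n) / (2 * real n * real n)"
      proof (rule frac_le[rotated 1])
        show "2 * real n * real n \<le> norm e" unfolding e by (intro mult_mono) auto
      qed (use n in \<open>auto simp: M_def\<close>)
      also have "\<dots> = M / real n" using n by simp
      finally show ?thesis .
    qed
    finally have "norm (u (Suc n) - u n) \<le> norm (u n) * (M / real n)" by (simp add: mult_left_mono)
    also have "\<dots> \<le> (K * real n powr (Re s - 1/2)) * (M / real n)"
      using ub[OF n] by (intro mult_right_mono) (auto simp: M_def)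
    also have "\<dots> = K * M * real n powr (Re s - 3/2)"
    proof -
      have "real n powr (Re s - 3/2) = real n powr (Re s - 1/2 - 1)" by simp
      also have "\<dots> = real n powr (Re s - 1/2) / real n" using n by (simp only: powr_diff) simp
      finally show ?thesis by simp
    qed
    finally show ?thesis .
  qed
  have "summable (\<lambda>n. K * M * real n powr (Re s - 3/2))"
    using s by (intro summable_mult) (simp add: summable_real_powr_iff)
  then show "summable (\<lambda>n. norm (u (Suc n) - u n))"
    by (rule summable_comparison_test[rotated]) (use db in auto)
qed

text \<open>Only the 3F2 factor is delicate at 1, where its series reaches the circle of
  convergence; it is treated as a function of y = x^2 on [0, 1].\<close>

lemma rhs_small_tendsto_1:
  assumes s: "Re s > 0" "Re s < 1/2" and X: "X \<longlonglongrightarrow> 1" "\<And>n. 0 < X n" "\<And>n. X n \<le> 1"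
  shows "(\<lambda>n. rhs_small s (X n)) \<longlonglongrightarrow> rhs_small s 1"
proof -
  define h where "h = (\<lambda>y::real. hypergeometric [s/2, (1 + s) / 2, 1] [1/4, 3/4] (- of_real y))"
  have "continuous_on {0..1} h"
    unfolding h_def hypergeometric_def eval_fps_def hypergeometric_small_coeff
    by (rule alternating_series_continuous[OF small_coeff_variation[OF s]])
  moreover have "(\<lambda>n. (X n)\<^sup>2) \<longlonglongrightarrow> 1\<^sup>2" by (intro tendsto_intros X)
  moreover have "(X n)\<^sup>2 \<in> {0..1}" for n using X(2,3)[of n] by (auto simp: power_le_one)
  ultimately have "(\<lambda>n. h ((X n)\<^sup>2)) \<longlonglongrightarrow> h (1\<^sup>2)"
    by (intro continuous_on_tendsto_compose[of "{0..1}" h]) auto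
  then have H: "(\<lambda>n. hypergeometric [s/2, (1 + s) / 2, 1] [1/4, 3/4] (- ((of_real (X n))\<^sup>2)))
      \<longlonglongrightarrow> hypergeometric [s/2, (1 + s) / 2, 1] [1/4, 3/4] (- ((of_real 1)\<^sup>2))"
    by (simp add: h_def)
  have "2 powr (s - 1) \<noteq> 0" "2 powr (s + 1) \<noteq> 0" by auto
  then show ?thesis
    unfolding rhs_small_def
    by (intro tendsto_intros H X) (auto simp: complex_nonpos_Reals_iff)
qed

lemma I_fun_at_1:
  assumes s: "Re s > 0" "Re s < 1/2" and lam: "- 1 < lam" "lam < 0"
  shows "I_fun lam s 1 = rhs_small s 1"
proof -
  define X where "X = (\<lambda>n. 1 - 1 / (real n + 2))"
  have X: "X \<longlonglongrightarrow> 1" unfolding X_def by real_asymp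
  have X01: "0 < X n" "X n < 1" for n by (auto simp: X_def field_simps)
  have "(\<lambda>n. I_fun lam s (X n)) \<longlonglongrightarrow> I_fun lam s 1"
    by (rule I_fun_tendsto[OF lam, of "\<lambda>_. s"]) (use s X X01 in auto)
  moreover have "I_fun lam s (X n) = rhs_small s (X n)" for n
    using X01 s lam by (intro I_fun_small) auto
  moreover have "(\<lambda>n. rhs_small s (X n)) \<longlonglongrightarrow> rhs_small s 1"
    using X01 by (intro rhs_small_tendsto_1[OF s X]) (auto intro: less_imp_le)
  ultimately show ?thesis using LIMSEQ_unique by simp
qed

section \<open>The limit as s tends to an integer\<close>

lemma I_fun_isCont_s:
  assumes "x > 0" "Re s > 0" "- 1 < lam" "lam < 0"
  shows "((\<lambda>w. I_fun lam w x) \<longlongrightarrow> I_fun lam s x) (at s)"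
proof -
  have "open {w. Re w > 0}" by (simp add: open_halfspace_Re_gt)
  then have eq: "at s within {w. Re w > 0} = at s" using assms by (intro at_within_open) auto
  have "((\<lambda>w. I_fun lam w x) \<longlongrightarrow> I_fun lam s x) (at s within {w. Re w > 0})"
    unfolding tendsto_at_iff_sequentially comp_def
    using assms by (intro allI impI I_fun_tendsto[of lam _ s "\<lambda>_. x" x]) auto
  then show ?thesis unfolding eq .
qed

lemma eventually_notin_Ints:
  assumes "s \<in> \<int>"
  shows "\<forall>\<^sub>F w in at (s :: complex). w \<notin> \<int>"
  unfolding eventually_at
proof (intro exI[of _ 1] conjI ballI impI)
  fix w assume w: "w \<noteq> s \<and> dist w s < 1"
  show "w \<notin> \<int>"
  proof
    assume "w \<in> \<int>"
    then have "w - s \<in> \<int>" using assms by (rule Ints_diff)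
    then obtain k :: int where k: "w - s = of_int k" by (auto elim: Ints_cases)
    then have "norm (w - s) = \<bar>of_int k\<bar>" by simp
    moreover have "k \<noteq> 0" using w k by auto
    then have "1 \<le> \<bar>real_of_int k\<bar>" by linarith
    ultimately show False using w by (simp add: dist_norm)
  qed
qed simp

text \<open>Near an integer s, the formula with coefficient 1 holds at every other w, and I is
  continuous in s. For odd s the coefficient is frozen at 0; the term dropped by this carries cot
  (pi w / 2), which tends to cot (pi s / 2) = 0, so the limit is unchanged.\<close>

lemma rhs_large_tendsto:
  assumes x: "1 < x" and s: "Re s > 0" "s \<in> \<int>" and lam: "- 1 < lam" "lam < 0"
  shows "((\<lambda>w. rhs_large (a_coeff s) w x) \<longlongrightarrow> I_fun lam s x) (at s)"
proof -
  have "open {w. Re w > 0}" by (simp add: open_halfspace_Re_gt)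
  then have "\<forall>\<^sub>F w in at s. Re w > 0"
    using s eventually_at_in_open'[of "{w. Re w > 0}" s] by simp
  with eventually_notin_Ints[OF s(2)] have "\<forall>\<^sub>F w in at s. I_fun lam w x = rhs_large 1 w x"
    by eventually_elim (use x lam in \<open>simp add: I_fun_large\<close>)
  then have one: "((\<lambda>w. rhs_large 1 w x) \<longlongrightarrow> I_fun lam s x) (at s)"
    using I_fun_isCont_s[of x s lam] x s lam by (simp add: tendsto_cong)
  show ?thesis
  proof (cases "\<exists>n::int. odd n \<and> s = of_int n")
    case False
    then have "a_coeff s = 1" unfolding a_coeff_def by (rule if_not_P)
    then show ?thesis using one by simp
  next
    case True
    then have a0: "a_coeff s = 0" unfolding a_coeff_def by (rule if_P)
    \<comment> \<open>The difference made by replacing coefficient 1 by 0, with the outer factor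
      included.\<close>
    define Q where "Q = (\<lambda>w. (of_real pi / 2 powr (2 - w)) * (of_real x powr (- w - 1) * cot (of_real pi * w / 2)
         / (2 powr (w + 1) * of_real (sqrt pi)) * Gamma (w + 1/2)
         * ((1 + \<i> / of_real x) powr (- (w + 1/2)) + (1 - \<i> / of_real x) powr (- (w + 1/2)))))"
    have alg: "- P * (A + 0 * U * V / W * G * B - C) = - P * (A + 1 * U * V / W * G * B - C) + P * (U * V / W * G * B)"
      for P A U V W G B C :: complex
      by (simp add: ring_distribs)
    have eq: "rhs_large 0 w x = rhs_large 1 w x + Q w" for w
      unfolding rhs_large_def Q_def by (rule alg)
    have c0: "cos (of_real pi * s / 2) = 0" using True by (simp only: cos_half_pi_eq_0_iff)
    have s0: "sin (of_real pi * s / 2) \<noteq> 0" using c0 by (metis sin_zero_norm_cos_one norm_zero zero_neq_one)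
    have "s + 1/2 \<notin> \<int>\<^sub>\<le>\<^sub>0" by (rule notin_nonpos_Ints_of_Re) (use s in auto)
    moreover have "2 powr (2 - s) \<noteq> 0" "2 powr (s + 1) \<noteq> 0" by auto
    ultimately have "(Q \<longlongrightarrow> Q s) (at s)"
      unfolding Q_def cot_def using x s0
      by (intro tendsto_intros) (auto simp: complex_nonpos_Reals_iff complex_eq_iff)
    moreover have "Q s = 0" by (simp add: Q_def cot_def c0)
    ultimately have "((\<lambda>w. rhs_large 1 w x + Q w) \<longlongrightarrow> I_fun lam s x + 0) (at s)"
      using one by (intro tendsto_add) auto
    then show ?thesis unfolding a0 eq by simp
  qed
qed

theorem lemma1p2:
  fixes s :: complex and x lam :: real
  assumes "Re s > 0" and "x > 0" and "- 1 < lam" and "lam < 0"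
  shows "vertical_integrable lam (integrand s x) \<and>
         (x > 1 \<longrightarrow>
            (if s \<in> \<nat> then ((\<lambda>w. rhs_large (a_coeff s) w x) \<longlongrightarrow> I_fun lam s x) (at s)
             else I_fun lam s x = rhs_large (a_coeff s) s x)) \<and>
         (x \<le> 1 \<and> (x = 1 \<longrightarrow> Re s < 1/2) \<longrightarrow> I_fun lam s x = rhs_small s x)"
proof (intro conjI impI)
  show "vertical_integrable lam (integrand s x)"
    using assms by (intro vertical_integrable_integrand)
next
  assume x: "x > 1"
  show "if s \<in> \<nat> then ((\<lambda>w. rhs_large (a_coeff s) w x) \<longlongrightarrow> I_fun lam s x) (at s)
        else I_fun lam s x = rhs_large (a_coeff s) s x"
  proof (cases "s \<in> \<nat>")
    case True
    then have "s \<in> \<int>" using Nats_subset_Ints by blast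
    then show ?thesis using True assms x by (simp add: rhs_large_tendsto)
  next
    case False
    have sI: "s \<notin> \<int>"
    proof
      assume "s \<in> \<int>"
      then obtain k where k: "s = of_int k" by (auto elim: Ints_cases)
      then have "s = of_nat (nat k)" using assms(1) by simp
      then show False using False by (metis of_nat_in_Nats)
    qed
    then have "a_coeff s = 1" by (auto simp: a_coeff_def)
    then show ?thesis using False I_fun_large[OF x assms(1) sI assms(3,4)] by simp
  qed
next
  assume x: "x \<le> 1 \<and> (x = 1 \<longrightarrow> Re s < 1/2)"
  show "I_fun lam s x = rhs_small s x"
  proof (cases "x = 1")
    case True
    then show ?thesis using x I_fun_at_1[of s lam] assms by simp
  next
    case False
    then show ?thesis using x assms by (intro I_fun_small) auto
  qed
qed

end
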